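(* Let $G$ be a compact metrizable topological group and let $d$ be an arbitrary left-invariant (or right-invariant) metric on $G$ which is compatible with (i.e. induces) the topology of $G$. Then the Lipschitz-free space $\mathcal{F}(G,d)$ has the metric approximation property.
   Context: A metric $d$ on a group $G$ is left-invariant if $d(gx,gy)=d(x,y)$ for all $g,x,y\in G$, and right-invariant if $d(xg,yg)=d(x,y)$ for all $g,x,y\in G$. For a metric space $M$ with a distinguished point $0\in M$, $\mathrm{Lip}_0(M)$ is the Banach space of real-valued Lipschitz functions on $M$ vanishing at $0$, normed by the minimal Lipschitz constant. The Lipschitz-free space $\mathcal{F}(M)$ is the closed linear span of $\{\delta(x):x\in M\}$ in $\mathrm{Lip}_0(M)^*$, where $\delta(x)(f)=f(x)$ (up to linear isometry it does not depend on the choice of $0$). A Banach space $X$ has the metric approximation property (MAP) if for each compact subset $K$ of $X$ and each $\epsilon>0$ there is a finite rank operator $T$ on $X$ with $\|T\|\le 1$ such that $\|Tx-x\|<\epsilon$ for each $x\in K$. *)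

theory Defs
  imports "HOL-Analysis.Analysis"
begin

text \<open>
  Groups are written additively, without any commutativity assumption: the class
  \<open>topological_group_add\<close> extends \<open>group_add\<close>, not \<open>ab_group_add\<close>.
  A group together with a compatible metric is a type of sort
  \<open>{metric_space, topological_group_add}\<close>, since \<open>metric_space\<close> requires the open
  sets to be those induced by \<open>dist\<close>.
\<close>

definition left_invariant_dist :: "'a::{metric_space, group_add} itself \<Rightarrow> bool"
  where "left_invariant_dist _ \<longleftrightarrow> (\<forall>g x y :: 'a. dist (g + x) (g + y) = dist x y)"

definition right_invariant_dist :: "'a::{metric_space, group_add} itself \<Rightarrow> bool"
  where "right_invariant_dist _ \<longleftrightarrow> (\<forall>g x y :: 'a. dist (x + g) (y + g) = dist x y)"

text \<open>
  A metric space with a distinguished point is a type of sort \<open>{metric_space, zero}\<close>;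
  for a group the distinguished point is thus the neutral element.
\<close>

typedef (overloaded) 'a lip0 =
  "{f :: 'a::{metric_space, zero} \<Rightarrow> real. f 0 = 0 \<and> (\<exists>C. C-lipschitz_on UNIV f)}"
  morphisms lip0_apply Lip0
  by (rule exI[of _ "\<lambda>_. 0"]) (auto intro: lipschitz_on_constant)

setup_lifting type_definition_lip0

lemma lip0_eqI: "(\<And>x. lip0_apply f x = lip0_apply g x) \<Longrightarrow> f = g"
  by transfer auto

lemma lip0_apply_zero [simp]: "lip0_apply f 0 = 0"
  by transfer auto

definition lip_const :: "('a::metric_space \<Rightarrow> real) \<Rightarrow> real"
  where "lip_const f = Inf {C. C-lipschitz_on UNIV f}"

lemma lip_const_le:
  assumes "C-lipschitz_on UNIV f"
  shows "lip_const f \<le> C"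
  unfolding lip_const_def using assms
  by (intro cInf_lower bdd_belowI[of _ 0]) (auto dest: lipschitz_on_nonneg)

lemma lipschitz_on_lip_const:
  fixes f :: "'a::metric_space \<Rightarrow> real"
  assumes "C-lipschitz_on UNIV f"
  shows "(lip_const f)-lipschitz_on UNIV f"
proof (rule lipschitz_onI)
  show "0 \<le> lip_const f"
    unfolding lip_const_def using assms
    by (intro cInf_greatest) (auto dest: lipschitz_on_nonneg)
next
  fix x y :: 'a
  show "dist (f x) (f y) \<le> lip_const f * dist x y"
  proof (cases "x = y")
    case False
    have "dist (f x) (f y) / dist x y \<le> lip_const f"
      unfolding lip_const_def using assms False
      by (intro cInf_greatest) (auto simp: divide_le_eq dest: lipschitz_onD)
    then show ?thesis
      using False by (simp add: divide_le_eq)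
  qed simp
qed

instantiation lip0 :: ("{metric_space, zero}") real_normed_vector
begin

lift_definition norm_lip0 :: "'a lip0 \<Rightarrow> real" is lip_const .

lift_definition zero_lip0 :: "'a lip0" is "\<lambda>_. 0"
  by (auto intro: lipschitz_on_constant)

lift_definition plus_lip0 :: "'a lip0 \<Rightarrow> 'a lip0 \<Rightarrow> 'a lip0" is "\<lambda>f g x. f x + g x"
  by (auto intro: lipschitz_on_add)

lift_definition minus_lip0 :: "'a lip0 \<Rightarrow> 'a lip0 \<Rightarrow> 'a lip0" is "\<lambda>f g x. f x - g x"
  by (auto intro: lipschitz_on_diff)

lift_definition uminus_lip0 :: "'a lip0 \<Rightarrow> 'a lip0" is "\<lambda>f x. - f x"
  by auto

lift_definition scaleR_lip0 :: "real \<Rightarrow> 'a lip0 \<Rightarrow> 'a lip0" is "\<lambda>r f x. r * f x"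
  by (auto intro: lipschitz_on_cmult_real)

definition dist_lip0 :: "'a lip0 \<Rightarrow> 'a lip0 \<Rightarrow> real"
  where "dist_lip0 f g = norm (f - g)"

definition sgn_lip0 :: "'a lip0 \<Rightarrow> 'a lip0"
  where "sgn_lip0 f = scaleR (inverse (norm f)) f"

definition [code del]:
  "(uniformity :: ('a lip0 \<times> 'a lip0) filter) = (INF e\<in>{0 <..}. principal {(x, y). dist x y < e})"

definition open_lip0 :: "'a lip0 set \<Rightarrow> bool"
  where [code del]: "open_lip0 S = (\<forall>x\<in>S. \<forall>\<^sub>F (x', y) in uniformity. x' = x \<longrightarrow> y \<in> S)"

instance
proof
  have lip: "(norm f)-lipschitz_on UNIV (lip0_apply f)" for f :: "'a lip0"
    by transfer (auto intro: lipschitz_on_lip_const)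
  have le: "norm f \<le> C" if "C-lipschitz_on UNIV (lip0_apply f)" for f :: "'a lip0" and C
    using that by transfer (rule lip_const_le)
  have nonneg: "0 \<le> norm f" for f :: "'a lip0"
    using lip lipschitz_on_nonneg by blast
  fix f g h :: "'a lip0" and r s :: real
  show "f + g + h = f + (g + h)" "f + g = g + f" "0 + f = f" "- f + f = 0" "f - g = f + - g"
    by (transfer; simp add: fun_eq_iff)+
  show "r *\<^sub>R (f + g) = r *\<^sub>R f + r *\<^sub>R g" "(r + s) *\<^sub>R f = r *\<^sub>R f + s *\<^sub>R f"
    "r *\<^sub>R s *\<^sub>R f = (r * s) *\<^sub>R f" "1 *\<^sub>R f = f"
    by (transfer; simp add: fun_eq_iff algebra_simps)+
  show "sgn f = scaleR (inverse (norm f)) f" by (rule sgn_lip0_def)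
  show "dist f g = norm (f - g)" by (rule dist_lip0_def)
  show "(uniformity :: ('a lip0 \<times> 'a lip0) filter)
      = (INF e\<in>{0 <..}. principal {(x, y). dist x y < e})"
    by (rule uniformity_lip0_def)
  show "open U = (\<forall>x\<in>U. \<forall>\<^sub>F (x', y) in uniformity. x' = x \<longrightarrow> y \<in> U)" for U :: "'a lip0 set"
    by (rule open_lip0_def)
  show "norm f = 0 \<longleftrightarrow> f = 0"
  proof
    assume "norm f = 0"
    then have "lip0_apply f x = 0" for x
      using lipschitz_onD[OF lip[of f], of x 0] by simp
    then show "f = 0" by (intro lip0_eqI) (simp add: zero_lip0.rep_eq)
  next
    assume "f = 0"
    then have "norm f \<le> 0"
      by (intro le) (simp add: zero_lip0.rep_eq lipschitz_on_constant)
    then show "norm f = 0" using nonneg[of f] by simp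
  qed
  show "norm (f + g) \<le> norm f + norm g"
    by (rule le) (simp add: plus_lip0.rep_eq lipschitz_on_add lip)
  have scale_le: "norm (a *\<^sub>R k) \<le> \<bar>a\<bar> * norm k" for a and k :: "'a lip0"
    by (rule le) (simp add: scaleR_lip0.rep_eq lipschitz_on_cmult_real lip)
  show "norm (r *\<^sub>R f) = \<bar>r\<bar> * norm f"
  proof (cases "r = 0")
    case True
    then show ?thesis using scale_le[of r f] nonneg[of "r *\<^sub>R f"] by simp
  next
    case False
    have "inverse r *\<^sub>R r *\<^sub>R f = f"
      using False by (intro lip0_eqI) (simp add: scaleR_lip0.rep_eq)
    with scale_le[of "inverse r" "r *\<^sub>R f"] have "\<bar>r\<bar> * norm f \<le> norm (r *\<^sub>R f)"
      using False by (simp add: field_simps)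
    with scale_le[of r f] show ?thesis by simp
  qed
qed

end

lemma lip0_dist_le: "\<bar>lip0_apply f x - lip0_apply f y\<bar> \<le> norm f * dist x y"
proof -
  have "(norm f)-lipschitz_on UNIV (lip0_apply f)"
    by transfer (auto intro: lipschitz_on_lip_const)
  from lipschitz_onD[OF this, of x y] show ?thesis by (simp add: dist_real_def)
qed

lift_definition lip_delta :: "'a::{metric_space, zero} \<Rightarrow> 'a lip0 \<Rightarrow>\<^sub>L real"
  is "\<lambda>x f. lip0_apply f x"
proof (rule bounded_linear_intro)
  fix x :: 'a and f g :: "'a lip0" and r :: real
  show "lip0_apply (f + g) x = lip0_apply f x + lip0_apply g x"
    by (simp add: plus_lip0.rep_eq)
  show "lip0_apply (r *\<^sub>R f) x = r *\<^sub>R lip0_apply f x"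
    by (simp add: scaleR_lip0.rep_eq)
  show "norm (lip0_apply f x) \<le> norm f * dist x 0"
    using lip0_dist_le[of f x 0] by simp
qed

typedef (overloaded) 'a lipschitz_free =
  "closure (span (range (lip_delta :: 'a::{metric_space, zero} \<Rightarrow> 'a lip0 \<Rightarrow>\<^sub>L real)))"
  morphisms functional_of_free Lipschitz_free
  by (metis closure_subset span_zero subsetD)

setup_lifting type_definition_lipschitz_free

lemma subspace_closure:
  fixes S :: "'b::real_normed_vector set"
  assumes "subspace S"
  shows "subspace (closure S)"
proof (rule subspaceI)
  show "0 \<in> closure S"
    using assms closure_subset subspace_0 by blast
next
  fix x y
  assume "x \<in> closure S" "y \<in> closure S"
  then obtain a b where "\<And>n. a n \<in> S" "a \<longlonglongrightarrow> x" "\<And>n. b n \<in> S" "b \<longlonglongrightarrow> y"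
    by (auto simp: closure_sequential)
  then show "x + y \<in> closure S"
    unfolding closure_sequential
    by (intro exI[of _ "\<lambda>n. a n + b n"]) (auto intro: subspace_add[OF assms] tendsto_add)
next
  fix c :: real and x
  assume "x \<in> closure S"
  then obtain a where "\<And>n. a n \<in> S" "a \<longlonglongrightarrow> x"
    by (auto simp: closure_sequential)
  then show "c *\<^sub>R x \<in> closure S"
    unfolding closure_sequential
    by (intro exI[of _ "\<lambda>n. c *\<^sub>R a n"])
      (auto intro: subspace_scale[OF assms] tendsto_scaleR tendsto_const)
qed

lemma subspace_closed_span_lip_delta: "subspace (closure (span (range lip_delta)))"
  by (rule subspace_closure) (rule subspace_span)

instantiation lipschitz_free :: ("{metric_space, zero}") real_normed_vector
begin

lift_definition norm_lipschitz_free :: "'a lipschitz_free \<Rightarrow> real" is norm .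

lift_definition zero_lipschitz_free :: "'a lipschitz_free" is 0
  by (rule subspace_0[OF subspace_closed_span_lip_delta])

lift_definition plus_lipschitz_free :: "'a lipschitz_free \<Rightarrow> 'a lipschitz_free \<Rightarrow> 'a lipschitz_free"
  is "(+)"
  by (rule subspace_add[OF subspace_closed_span_lip_delta])

lift_definition minus_lipschitz_free :: "'a lipschitz_free \<Rightarrow> 'a lipschitz_free \<Rightarrow> 'a lipschitz_free"
  is "(-)"
  by (rule subspace_diff[OF subspace_closed_span_lip_delta])

lift_definition uminus_lipschitz_free :: "'a lipschitz_free \<Rightarrow> 'a lipschitz_free" is uminus
  by (rule subspace_neg[OF subspace_closed_span_lip_delta])

lift_definition scaleR_lipschitz_free :: "real \<Rightarrow> 'a lipschitz_free \<Rightarrow> 'a lipschitz_free"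
  is scaleR
  by (rule subspace_scale[OF subspace_closed_span_lip_delta])

definition dist_lipschitz_free :: "'a lipschitz_free \<Rightarrow> 'a lipschitz_free \<Rightarrow> real"
  where "dist_lipschitz_free u v = norm (u - v)"

definition sgn_lipschitz_free :: "'a lipschitz_free \<Rightarrow> 'a lipschitz_free"
  where "sgn_lipschitz_free u = scaleR (inverse (norm u)) u"

definition [code del]:
  "(uniformity :: ('a lipschitz_free \<times> 'a lipschitz_free) filter)
    = (INF e\<in>{0 <..}. principal {(x, y). dist x y < e})"

definition open_lipschitz_free :: "'a lipschitz_free set \<Rightarrow> bool"
  where [code del]:
    "open_lipschitz_free S = (\<forall>x\<in>S. \<forall>\<^sub>F (x', y) in uniformity. x' = x \<longrightarrow> y \<in> S)"

instance
proof
  fix u v w :: "'a lipschitz_free" and r s :: real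
  show "u + v + w = u + (v + w)" "u + v = v + u" "0 + u = u" "- u + u = 0" "u - v = u + - v"
    by (transfer; simp add: algebra_simps)+
  show "r *\<^sub>R (u + v) = r *\<^sub>R u + r *\<^sub>R v" "(r + s) *\<^sub>R u = r *\<^sub>R u + s *\<^sub>R u"
    "r *\<^sub>R s *\<^sub>R u = (r * s) *\<^sub>R u" "1 *\<^sub>R u = u"
    by (transfer; simp add: algebra_simps)+
  show "sgn u = scaleR (inverse (norm u)) u" by (rule sgn_lipschitz_free_def)
  show "dist u v = norm (u - v)" by (rule dist_lipschitz_free_def)
  show "(uniformity :: ('a lipschitz_free \<times> 'a lipschitz_free) filter)
      = (INF e\<in>{0 <..}. principal {(x, y). dist x y < e})"
    by (rule uniformity_lipschitz_free_def)
  show "open U = (\<forall>x\<in>U. \<forall>\<^sub>F (x', y) in uniformity. x' = x \<longrightarrow> y \<in> U)"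
    for U :: "'a lipschitz_free set"
    by (rule open_lipschitz_free_def)
  show "norm u = 0 \<longleftrightarrow> u = 0" by transfer simp
  show "norm (u + v) \<le> norm u + norm v" by transfer (rule norm_triangle_ineq)
  show "norm (r *\<^sub>R u) = \<bar>r\<bar> * norm u" by transfer simp
qed

end

instance lipschitz_free :: ("{metric_space, zero}") banach
proof
  fix X :: "nat \<Rightarrow> 'a lipschitz_free"
  let ?R = "functional_of_free :: 'a lipschitz_free \<Rightarrow> _"
  have dist_eq: "dist (?R u) (?R v) = dist u v" for u v
    unfolding dist_norm by transfer simp
  assume "Cauchy X"
  then have "Cauchy (\<lambda>n. ?R (X n))"
    unfolding Cauchy_def dist_eq .
  then obtain l where l: "(\<lambda>n. ?R (X n)) \<longlonglongrightarrow> l"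
    using Cauchy_convergent convergent_def by blast
  have "l \<in> closure (span (range (lip_delta :: 'a \<Rightarrow> _)))"
    using closed_closure functional_of_free l by (rule closed_sequentially)
  then have "l = ?R (Lipschitz_free l)"
    by (simp add: Lipschitz_free_inverse)
  with l have "(\<lambda>n. ?R (X n)) \<longlonglongrightarrow> ?R (Lipschitz_free l)" by simp
  then have "X \<longlonglongrightarrow> Lipschitz_free l"
    unfolding tendsto_iff dist_eq .
  then show "convergent X" by (rule convergentI)
qed

definition finite_rank :: "('b::real_normed_vector \<Rightarrow>\<^sub>L 'c::real_normed_vector) \<Rightarrow> bool"
  where "finite_rank T \<longleftrightarrow> (\<exists>B. finite B \<and> range (blinfun_apply T) \<subseteq> span B)"

definition metric_approximation_property :: "'b::banach itself \<Rightarrow> bool"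
  where "metric_approximation_property _ \<longleftrightarrow>
    (\<forall>K :: 'b set. compact K \<longrightarrow>
      (\<forall>\<epsilon>>0. \<exists>T :: 'b \<Rightarrow>\<^sub>L 'b. finite_rank T \<and> norm T \<le> 1 \<and>
        (\<forall>x\<in>K. norm (blinfun_apply T x - x) < \<epsilon>)))"

end

theory Submission
  imports Defs
begin

text \<open>
  Averaging a Lipschitz function over left translates, \<open>f \<mapsto> (\<lambda>x. \<integral> k h * f (h x) dh)\<close> with
  \<open>k\<close> integrated against Haar measure, does not increase the Lipschitz constant by more than
  \<open>\<integral> \<bar>k\<bar>\<close>, because the metric is left-invariant. If the right translates of \<open>k\<close> span a
  finite-dimensional space, the average is an operator of finite rank (substitute
  \<open>h \<mapsto> h x\<inverse>\<close>), and if \<open>k\<close> is close in \<open>L\<^sup>1\<close> to a bump at the neutral element, the operator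
  is close to the identity on point masses. Such \<open>k\<close> exist since eigenspaces of convolution with
  a symmetric bump are finite-dimensional and invariant under right translation.

  Haar measure is needed only as a functional on continuous functions, and is obtained as the limit
  of averages over minimal \<open>\<epsilon>\<close>-nets. A right-invariant metric is left-invariant for the opposite
  group, so the group operation is a locale parameter.
\<close>

section \<open>Averages over minimal nets and the Haar functional\<close>

text \<open>The definition asks for norm at most 1, but spectral truncation destroys positivity: the
  kernel \<open>k\<close> may take negative values. What survives is that k is L1-close to a bump w
  of mass 1, so the integral of |k| is at most 1 + r, and division by 1 + r brings the norm down to
  1 at a cost of order r on point masses. Since only an L1 estimate is asked of the truncation, L2
  orthogonality suffices, and no uniform convergence of eigenfunction expansions enters. The
  spectral theory is done on C(G), which need not be complete for the L2 inner product. Limits are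
  taken in the sup norm, because convolution sends the L2 unit ball into a sup-norm compact set.
  Averaging takes place on Lip_0, and the operator on the free space is precomposition with it. This
  stays inside the free space because integration against a continuous density is a limit of
  combinations of point masses. Invariance on one side only has two effects: right invariance of the
  Haar functional has to come through inversion, and closeness of h x to x for h near the neutral
  element has to come from compactness.\<close>

text \<open>Comparing the sizes of superlevel sets does the work of a matching between
  \<open>A\<close> and \<open>B\<close>. Remove a maximum from each side: the hypothesis at t = f a
  gives f a \<le> g b, so for t \<le> f a both counts drop by one, and for larger t the left one is
  zero.\<close>

lemma sum_le_sum_by_counting:
  fixes f :: "'a \<Rightarrow> real" and g :: "'b \<Rightarrow> real"
  assumes "finite A" "finite B" "card A = card B"
    and "\<And>t. card {a \<in> A. t \<le> f a} \<le> card {b \<in> B. t \<le> g b}"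
  shows "sum f A \<le> sum g B"
  using assms
proof (induction "card A" arbitrary: A B)
  case 0
  then show ?case by simp
next
  case (Suc n)
  then have "A \<noteq> {}" "B \<noteq> {}" by auto
  obtain a where a: "a \<in> A" "\<And>x. x \<in> A \<Longrightarrow> f x \<le> f a"
    using obtains_MAX[OF \<open>finite A\<close> \<open>A \<noteq> {}\<close>, of f] \<open>finite A\<close> by (metis Max_ge finite_imageI imageI)
  obtain b where b: "b \<in> B" "\<And>x. x \<in> B \<Longrightarrow> g x \<le> g b"
    using obtains_MAX[OF \<open>finite B\<close> \<open>B \<noteq> {}\<close>, of g] \<open>finite B\<close> by (metis Max_ge finite_imageI imageI)
  have fa: "f a \<le> g b"
  proof -
    have "0 < card {x \<in> A. f a \<le> f x}"
      using a \<open>finite A\<close> by (auto simp: card_gt_0_iff)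
    also have "\<dots> \<le> card {y \<in> B. f a \<le> g y}" by (rule Suc.prems)
    finally have "{y \<in> B. f a \<le> g y} \<noteq> {}" by (metis card.empty less_irrefl)
    then show ?thesis using b(2) by force
  qed
  have "sum f (A - {a}) \<le> sum g (B - {b})"
  proof (rule Suc.hyps)
    show "n = card (A - {a})" "card (A - {a}) = card (B - {b})"
      using Suc.prems Suc.hyps(2) a b by auto
    fix t
    show "card {x \<in> A - {a}. t \<le> f x} \<le> card {y \<in> B - {b}. t \<le> g y}" (is ?goal)
    proof (cases "t \<le> f a")
      case True
      have "{x \<in> A - {a}. t \<le> f x} = {x \<in> A. t \<le> f x} - {a}"
        "{y \<in> B - {b}. t \<le> g y} = {y \<in> B. t \<le> g y} - {b}" by auto
      moreover have "a \<in> {x \<in> A. t \<le> f x}" "b \<in> {y \<in> B. t \<le> g y}"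
        using True fa a(1) b(1) by auto
      ultimately show ?goal
        using Suc.prems(4)[of t] by (simp only: card_Diff_singleton diff_le_mono)
    next
      case False
      then have "{x \<in> A - {a}. t \<le> f x} = {}" using a(2) by force
      then show ?goal by (simp only: card.empty zero_le)
    qed
  qed (use Suc.prems in auto)
  then show ?case
    using fa a b Suc.prems by (simp add: sum.remove[of A a] sum.remove[of B b])
qed

text \<open>Minimality refers to cardinality, not inclusion. All minimal nets at one scale then have
  equally many points, and any net obtained by exchanging points can be compared with them.\<close>

definition min_net :: "real \<Rightarrow> 'a::metric_space set \<Rightarrow> bool"
  where "min_net e N \<longleftrightarrow> finite N \<and> (\<forall>y. \<exists>x\<in>N. dist x y < e) \<and>
    (\<forall>M :: 'a set. finite M \<and> (\<forall>y. \<exists>x\<in>M. dist x y < e) \<longrightarrow> card N \<le> card M)"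

lemma ex_min_net:
  assumes "compact (UNIV :: 'a::metric_space set)" "0 < e"
  shows "\<exists>N :: 'a set. min_net e N"
proof -
  let ?P = "\<lambda>N :: 'a set. finite N \<and> (\<forall>y. \<exists>x\<in>N. dist x y < e)"
  have "\<exists>N. ?P N"
    using assms unfolding compact_eq_totally_bounded by (metis (no_types, lifting) UNIV_I UN_E mem_ball subsetD)
  then obtain N where "?P N" by blast
  from ex_has_least_nat[of ?P N card, OF this] show ?thesis
    unfolding min_net_def by blast
qed

lemma min_net_card_pos:
  assumes "min_net e N"
  shows "0 < card N"
  using assms unfolding min_net_def by (metis card_gt_0_iff empty_iff)

lemma min_net_card_le:
  fixes M N :: "'a::metric_space set"
  assumes "min_net e N" "\<And>y. \<exists>x\<in>M. dist x y < e" "finite M"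
  shows "card N \<le> card M"
  using assms(1)[unfolded min_net_def, THEN conjunct2, THEN conjunct2, THEN spec, of M] assms(2,3)
  by blast

definition avg :: "'a set \<Rightarrow> ('a \<Rightarrow> real) \<Rightarrow> real"
  where "avg N f = sum f N / card N"

text \<open>An exchange argument. In \<open>N\<close>, replace the points where f \<ge> t by the
  points of \<open>N'\<close> within 2e of them. The result is still a net, so minimality of
  \<open>N\<close> shows that the superlevel set in \<open>N\<close> is no larger than its
  replacement, on which f is at least t - r.\<close>

lemma avg_le_avg_min_net:
  assumes N: "min_net e N" and N': "min_net e N'"
    and f: "\<And>x y. dist x y < 2 * e \<Longrightarrow> f x \<le> f y + r"
  shows "avg N f \<le> avg N' f + r"
proof -
  have fin: "finite N" "finite N'" using N N' by (auto simp: min_net_def)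
  have card: "card N = card N'" using N N' unfolding min_net_def by (meson le_antisym)
  have "sum f N \<le> (\<Sum>y\<in>N'. f y + r)"
  proof (rule sum_le_sum_by_counting[OF fin card])
    fix t
    let ?S = "{x \<in> N. t \<le> f x}" and ?S' = "{y \<in> N'. \<exists>x\<in>N. t \<le> f x \<and> dist x y < 2 * e}"
    \<comment> \<open>If the point \<open>x\<close> of \<open>N\<close> covering \<open>z\<close>
      was removed, the point \<open>y\<close> of \<open>N'\<close> covering \<open>z\<close> lies
      within 2e of \<open>x\<close>, hence belongs to \<open>?S'\<close>.\<close>
    have "\<exists>x\<in>(N - ?S) \<union> ?S'. dist x z < e" for z
    proof -
      obtain x where x: "x \<in> N" "dist x z < e" using N unfolding min_net_def by blast
      obtain y where y: "y \<in> N'" "dist y z < e" using N' unfolding min_net_def by blast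
      have "dist x y < 2 * e" using x y dist_triangle2[of x y z] by simp
      with x y show ?thesis by (cases "t \<le> f x") auto
    qed
    moreover have "finite ((N - ?S) \<union> ?S')" using fin by simp
    ultimately have "card N \<le> card ((N - ?S) \<union> ?S')"
      by (intro min_net_card_le[OF N])
    also have "\<dots> \<le> card (N - ?S) + card ?S'" by (rule card_Un_le)
    also have "card (N - ?S) = card N - card ?S" using fin by (intro card_Diff_subset) auto
    finally have "card ?S \<le> card ?S'"
      using card_mono[of N ?S] fin by auto
    also have "\<dots> \<le> card {y \<in> N'. t \<le> f y + r}"
    proof (rule card_mono)
      show "?S' \<subseteq> {y \<in> N'. t \<le> f y + r}" using f by (auto intro: order_trans)
    qed (use fin in auto)
    finally show "card ?S \<le> card {y \<in> N'. t \<le> f y + r}" .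
  qed
  also have "\<dots> = sum f N' + card N' * r" by (simp add: sum.distrib)
  finally show ?thesis
    using min_net_card_pos[OF N'] card by (simp add: avg_def field_simps)
qed

lemma avg_min_net_close:
  assumes "min_net e N" "min_net e N'"
    and "\<And>x y. dist x y < 2 * e \<Longrightarrow> \<bar>f x - f y\<bar> \<le> r"
  shows "\<bar>avg N f - avg N' f\<bar> \<le> r"
proof -
  have "f x \<le> f y + r" if "dist x y < 2 * e" for x y
    using assms(3)[OF that] by simp
  from avg_le_avg_min_net[OF assms(1,2), of f r] avg_le_avg_min_net[OF assms(2,1), of f r] this
  show ?thesis by auto
qed

lemma avg_mono: "(\<And>x. f x \<le> g x) \<Longrightarrow> avg N f \<le> avg N g"
  unfolding avg_def by (intro divide_right_mono sum_mono) auto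

lemma avg_add: "avg N (\<lambda>x. f x + g x) = avg N f + avg N g"
  unfolding avg_def by (simp add: sum.distrib add_divide_distrib)

lemma avg_cmult: "avg N (\<lambda>x. c * f x) = c * avg N f"
  unfolding avg_def by (simp add: sum_distrib_left)

lemma avg_swap: "avg N (\<lambda>x. avg M (f x)) = avg M (\<lambda>y. avg N (\<lambda>x. f x y))"
  unfolding avg_def by (subst (1 2) sum_divide_distrib[symmetric]) (simp add: sum.swap[of _ M N] mult.commute)

lemma avg_const: "0 < card N \<Longrightarrow> avg N (\<lambda>x. c) = c"
  unfolding avg_def by simp

lemma avg_close:
  assumes "0 < card N" "\<And>x. \<bar>f x - c\<bar> \<le> r"
  shows "\<bar>avg N f - c\<bar> \<le> r"
proof -
  have "f x \<le> c + r" "c - r \<le> f x" for x using assms(2)[of x] by auto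
  then show ?thesis
    using avg_mono[of f "\<lambda>_. c + r" N] avg_mono[of "\<lambda>_. c - r" f N] assms(1)
    by (simp add: avg_const abs_le_iff)
qed

section \<open>Compact groups with a left-invariant metric\<close>

locale compact_metric_group = group mul 0 ginv
  for mul :: "'a::{metric_space, zero} \<Rightarrow> 'a \<Rightarrow> 'a" (infixl \<open>\<odot>\<close> 70) and ginv :: "'a \<Rightarrow> 'a" +
  assumes compact_UNIV: "compact (UNIV :: 'a set)"
    and continuous_mul: "continuous_on UNIV (\<lambda>(x, y). x \<odot> y)"
    and continuous_ginv: "continuous_on UNIV ginv"
    and dist_mul_left [simp]: "dist (g \<odot> x) (g \<odot> y) = dist x y"
begin

lemma continuous_on_mul [continuous_intros]:
  assumes "continuous_on S f" "continuous_on S g"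
  shows "continuous_on S (\<lambda>x. f x \<odot> g x)"
  using continuous_on_compose2[OF continuous_mul continuous_on_Pair[OF assms]] by simp

lemma continuous_on_ginv [continuous_intros]:
  assumes "continuous_on S f"
  shows "continuous_on S (\<lambda>x. ginv (f x))"
  using continuous_on_compose2[OF continuous_ginv assms] by simp

lemma mul_ginv_cancel [simp]: "g \<odot> (ginv g \<odot> x) = x" "ginv g \<odot> (g \<odot> x) = x"
  "x \<odot> ginv g \<odot> g = x" "x \<odot> g \<odot> ginv g = x"
  by (simp_all add: assoc[symmetric]) (simp_all add: assoc)

lemma dist_left_eq: "dist (g \<odot> x) y = dist x (ginv g \<odot> y)"
  using dist_mul_left[of "ginv g" "g \<odot> x" y] by simp

lemma uniformly_continuous:
  fixes f :: "'a \<Rightarrow> real"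
  assumes "continuous_on UNIV f" "0 < r"
  obtains d where "0 < d" "\<And>x y. dist x y < d \<Longrightarrow> \<bar>f x - f y\<bar> < r"
  using compact_uniformly_continuous[OF assms(1) compact_UNIV] assms(2)
  unfolding uniformly_continuous_on_def dist_real_def by (metis UNIV_I)

text \<open>Left translations are isometries; this is the source of the left invariance of
  \<open>haar\<close>.\<close>

lemma min_net_translate:
  assumes "min_net e N"
  shows "min_net e ((\<odot>) g ` N)"
proof -
  have inj: "inj_on ((\<odot>) g) N" by (auto simp: inj_on_def left_cancel)
  show ?thesis
    using assms unfolding min_net_def card_image[OF inj] by (auto simp: dist_left_eq)
qed

lemma avg_translate: "avg ((\<odot>) g ` N) f = avg N (\<lambda>x. f (g \<odot> x))"
proof -
  have inj: "inj_on ((\<odot>) g) N" by (auto simp: inj_on_def left_cancel)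
  show ?thesis unfolding avg_def by (simp add: sum.reindex[OF inj] card_image[OF inj])
qed

lemma avg_left_translate:
  assumes "min_net e N" "\<And>x y. dist x y < 2 * e \<Longrightarrow> \<bar>f x - f y\<bar> \<le> r"
  shows "\<bar>avg N (\<lambda>x. f (g \<odot> x)) - avg N f\<bar> \<le> r"
  using avg_min_net_close[OF min_net_translate[OF assms(1)] assms(1), of f r g] assms(2)
  by (simp add: avg_translate)

text \<open>Averaging \<open>f (ginv y \<odot> x)\<close> over both variables, in either order, compares a nearly
  left-invariant mean with a nearly right-invariant one.\<close>
lemma avg_ginv_close:
  assumes N: "min_net e N" and f: "\<And>x y. dist x y < 2 * e \<Longrightarrow> \<bar>f x - f y\<bar> \<le> r"
    and N': "min_net e' N'"
    and f': "\<And>x y. dist x y < 2 * e' \<Longrightarrow> \<bar>f (ginv x) - f (ginv y)\<bar> \<le> r"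
  shows "\<bar>avg N f - avg N' (\<lambda>y. f (ginv y))\<bar> \<le> 2 * r"
proof -
  have "\<bar>avg N' (\<lambda>y. avg N (\<lambda>x. f (ginv y \<odot> x))) - avg N f\<bar> \<le> r"
    by (rule avg_close[OF min_net_card_pos[OF N'] avg_left_translate[OF N f]])
  moreover have "\<bar>avg N (\<lambda>x. avg N' (\<lambda>y. f (ginv (ginv x \<odot> y)))) - avg N' (\<lambda>y. f (ginv y))\<bar> \<le> r"
    by (rule avg_close[OF min_net_card_pos[OF N]
          avg_left_translate[OF N', where f = "\<lambda>y. f (ginv y)", OF f']])
  ultimately show ?thesis
    by (simp add: inverse_distrib_swap avg_swap[of N])
qed

section \<open>The Haar functional and its invariance\<close>

definition net :: "nat \<Rightarrow> 'a set"
  where "net n = (SOME N. min_net (inverse (real (Suc n))) N)"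

lemma min_net_net: "min_net (inverse (real (Suc n))) (net n)"
  unfolding net_def by (rule someI_ex[OF ex_min_net[OF compact_UNIV]]) simp

definition haar :: "('a \<Rightarrow> real) \<Rightarrow> real"
  where "haar f = lim (\<lambda>n. avg (net n) f)"

text \<open>The two indices are independent. Comparing minimal nets directly works at one scale
  only; a mean of the inverted function at a fixed scale serves as a common reference for means of
  \<open>f\<close> at all finer scales.\<close>

lemma avg_net_ginv_close:
  assumes f: "continuous_on UNIV f" and r: "0 < r"
  shows "\<exists>k. \<forall>m\<ge>k. \<forall>n\<ge>k. \<bar>avg (net m) f - avg (net n) (\<lambda>y. f (ginv y))\<bar> \<le> r"
proof -
  from uniformly_continuous[OF f, of "r / 2"] r obtain d where d: "0 < d"
    "\<And>x y. dist x y < d \<Longrightarrow> \<bar>f x - f y\<bar> < r / 2" by auto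
  have "continuous_on UNIV (\<lambda>y. f (ginv y))"
    by (intro continuous_on_compose2[OF f] continuous_intros) auto
  from uniformly_continuous[OF this, of "r / 2"] r obtain d' where d': "0 < d'"
    "\<And>x y. dist x y < d' \<Longrightarrow> \<bar>f (ginv x) - f (ginv y)\<bar> < r / 2" by auto
  obtain k where k: "inverse (real (Suc k)) < min d d' / 2"
    using reals_Archimedean[of "min d d' / 2"] d(1) d'(1) by auto
  have small: "2 * inverse (real (Suc n)) < min d d'" if "k \<le> n" for n
  proof -
    have "inverse (real (Suc n)) \<le> inverse (real (Suc k))"
      using that by (intro le_imp_inverse_le) auto
    with k show ?thesis by linarith
  qed
  show ?thesis
  proof (intro exI[of _ k] allI impI)
    fix m n assume "k \<le> m" "k \<le> n"
    have "\<bar>avg (net m) f - avg (net n) (\<lambda>y. f (ginv y))\<bar> \<le> 2 * (r / 2)"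
    proof (rule avg_ginv_close[OF min_net_net _ min_net_net])
      fix x y :: 'a
      show "\<bar>f x - f y\<bar> \<le> r / 2" if "dist x y < 2 * inverse (real (Suc m))"
        using d(2)[of x y] small[OF \<open>k \<le> m\<close>] that by auto
      show "\<bar>f (ginv x) - f (ginv y)\<bar> \<le> r / 2" if "dist x y < 2 * inverse (real (Suc n))"
        using d'(2)[of x y] small[OF \<open>k \<le> n\<close>] that by auto
    qed
    then show "\<bar>avg (net m) f - avg (net n) (\<lambda>y. f (ginv y))\<bar> \<le> r" by simp
  qed
qed

lemma haar_tendsto:
  assumes f: "continuous_on UNIV f"
  shows "(\<lambda>n. avg (net n) f) \<longlonglongrightarrow> haar f"
proof -
  have "Cauchy (\<lambda>n. avg (net n) f)"
    unfolding Cauchy_def dist_real_def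
  proof (intro allI impI)
    fix e :: real assume "0 < e"
    with avg_net_ginv_close[OF f, of "e / 3"] obtain k where k:
      "\<And>m n. m \<ge> k \<Longrightarrow> n \<ge> k \<Longrightarrow> \<bar>avg (net m) f - avg (net n) (\<lambda>y. f (ginv y))\<bar> \<le> e / 3"
      by auto
    show "\<exists>M. \<forall>m\<ge>M. \<forall>n\<ge>M. \<bar>avg (net m) f - avg (net n) f\<bar> < e"
    proof (intro exI[of _ k] allI impI)
      fix m n assume "k \<le> m" "k \<le> n"
      \<comment> \<open>The pivot is the mean of the inverted function over \<open>net k\<close>;
        two errors of e/3 stay strictly below e.\<close>
      with k[of m k] k[of n k] order_refl \<open>0 < e\<close> show "\<bar>avg (net m) f - avg (net n) f\<bar> < e" by linarith
    qed
  qed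
  then show ?thesis
    unfolding haar_def by (simp add: Cauchy_convergent_iff convergent_LIMSEQ_iff)
qed

lemma haar_add:
  assumes "continuous_on UNIV f" "continuous_on UNIV g"
  shows "haar (\<lambda>x. f x + g x) = haar f + haar g"
proof -
  have "(\<lambda>n. avg (net n) (\<lambda>x. f x + g x)) \<longlonglongrightarrow> haar f + haar g"
    unfolding avg_add by (intro tendsto_add haar_tendsto assms)
  then show ?thesis unfolding haar_def by (rule limI)
qed

lemma haar_cmult:
  assumes "continuous_on UNIV f"
  shows "haar (\<lambda>x. c * f x) = c * haar f"
proof -
  have "(\<lambda>n. avg (net n) (\<lambda>x. c * f x)) \<longlonglongrightarrow> c * haar f"
    unfolding avg_cmult by (intro tendsto_mult_left haar_tendsto assms)
  then show ?thesis unfolding haar_def by (rule limI)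
qed

lemma haar_const [simp]: "haar (\<lambda>x. c) = c"
proof -
  have "(\<lambda>n. avg (net n) (\<lambda>x. c)) \<longlonglongrightarrow> c"
    by (simp add: avg_const[OF min_net_card_pos[OF min_net_net]])
  then show ?thesis unfolding haar_def by (rule limI)
qed

lemma haar_mono:
  assumes "continuous_on UNIV f" "continuous_on UNIV g" "\<And>x. f x \<le> g x"
  shows "haar f \<le> haar g"
  using assms by (intro LIMSEQ_le[OF haar_tendsto haar_tendsto]) (auto intro: avg_mono)

text \<open>The estimate that gives convergence, read with equal indices, already gives invariance
  under inversion.\<close>

lemma haar_ginv:
  assumes f: "continuous_on UNIV f"
  shows "haar (\<lambda>x. f (ginv x)) = haar f"
proof -
  have f': "continuous_on UNIV (\<lambda>y. f (ginv y))"
    by (intro continuous_on_compose2[OF f] continuous_intros) auto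
  have "\<bar>haar f - haar (\<lambda>x. f (ginv x))\<bar> \<le> e" if "0 < e" for e
  proof -
    from avg_net_ginv_close[OF f that] obtain k where k:
      "\<And>n. n \<ge> k \<Longrightarrow> \<bar>avg (net n) f - avg (net n) (\<lambda>y. f (ginv y))\<bar> \<le> e"
      by auto
    have "(\<lambda>n. \<bar>avg (net n) f - avg (net n) (\<lambda>y. f (ginv y))\<bar>) \<longlonglongrightarrow> \<bar>haar f - haar (\<lambda>x. f (ginv x))\<bar>"
      by (intro tendsto_intros haar_tendsto f f')
    then show ?thesis by (rule LIMSEQ_le_const2) (use k in blast)
  qed
  from field_le_epsilon[of "\<bar>haar f - haar (\<lambda>x. f (ginv x))\<bar>" 0] this show ?thesis by simp
qed

lemma haar_left:
  assumes f: "continuous_on UNIV f"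
  shows "haar (\<lambda>x. f (g \<odot> x)) = haar f"
proof -
  have f': "continuous_on UNIV (\<lambda>y. f (g \<odot> y))"
    by (intro continuous_on_compose2[OF f] continuous_intros) auto
  have "\<bar>haar (\<lambda>x. f (g \<odot> x)) - haar f\<bar> \<le> e" if "0 < e" for e
  proof -
    from uniformly_continuous[OF f that] obtain d where d: "0 < d"
      "\<And>x y. dist x y < d \<Longrightarrow> \<bar>f x - f y\<bar> < e" by auto
    obtain k where k: "inverse (real (Suc k)) < d / 2"
      using reals_Archimedean[of "d / 2"] d(1) by auto
    have le: "\<bar>avg (net n) (\<lambda>x. f (g \<odot> x)) - avg (net n) f\<bar> \<le> e" if "k \<le> n" for n
    proof (rule avg_left_translate[OF min_net_net])
      fix x y :: 'a
      have "inverse (real (Suc n)) \<le> inverse (real (Suc k))"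
        using that by (intro le_imp_inverse_le) auto
      then show "\<bar>f x - f y\<bar> \<le> e" if "dist x y < 2 * inverse (real (Suc n))"
        using k d(2)[of x y] that by linarith
    qed
    have "(\<lambda>n. \<bar>avg (net n) (\<lambda>x. f (g \<odot> x)) - avg (net n) f\<bar>) \<longlonglongrightarrow> \<bar>haar (\<lambda>x. f (g \<odot> x)) - haar f\<bar>"
      by (intro tendsto_intros haar_tendsto f f')
    then show ?thesis by (rule LIMSEQ_le_const2) (use le in blast)
  qed
  from field_le_epsilon[of "\<bar>haar (\<lambda>x. f (g \<odot> x)) - haar f\<bar>" 0] this show ?thesis by simp
qed

text \<open>Right translations need not be isometries, so nets give nothing here. Inversion
  conjugates right translations into left ones, and \<open>haar\<close> is invariant under both of
  those.\<close>

lemma haar_right: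
  assumes f: "continuous_on UNIV f"
  shows "haar (\<lambda>x. f (x \<odot> g)) = haar f"
proof -
  have f': "continuous_on UNIV (\<lambda>y. f (ginv y))" "continuous_on UNIV (\<lambda>x. f (x \<odot> g))"
    by (intro continuous_on_compose2[OF f] continuous_intros; simp)+
  have "haar (\<lambda>x. f (x \<odot> g)) = haar (\<lambda>x. f (ginv (ginv g \<odot> x)))"
    using haar_ginv[OF f'(2)] by (simp add: inverse_distrib_swap)
  also have "\<dots> = haar f"
    using haar_left[OF f'(1)] haar_ginv[OF f] by simp
  finally show ?thesis .
qed

lemma haar_sum:
  assumes "\<And>i. i \<in> S \<Longrightarrow> continuous_on UNIV (f i)"
  shows "haar (\<lambda>x. \<Sum>i\<in>S. f i x) = (\<Sum>i\<in>S. haar (f i))"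
  using assms by (induction S rule: infinite_finite_induct) (auto simp: haar_add continuous_on_sum)

lemma haar_diff:
  assumes "continuous_on UNIV f" "continuous_on UNIV g"
  shows "haar (\<lambda>x. f x - g x) = haar f - haar g"
  using haar_add[of f "\<lambda>x. (-1) * g x"] haar_cmult[of g "-1"] assms
  by (simp add: continuous_on_minus)

lemma haar_nonneg:
  assumes "continuous_on UNIV f" "\<And>x. 0 \<le> f x"
  shows "0 \<le> haar f"
  using haar_mono[of "\<lambda>_. 0" f] assms by simp

lemma haar_abs_le:
  assumes "continuous_on UNIV f"
  shows "\<bar>haar f\<bar> \<le> haar (\<lambda>x. \<bar>f x\<bar>)"
  using haar_mono[of f "\<lambda>x. \<bar>f x\<bar>"] haar_mono[of "\<lambda>x. (-1) * f x" "\<lambda>x. \<bar>f x\<bar>"]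
    haar_cmult[of f "-1"] assms
  by (fastforce intro: continuous_intros)

lemma haar_close:
  assumes "continuous_on UNIV f" "continuous_on UNIV g" "\<And>x. \<bar>f x - g x\<bar> \<le> r"
  shows "\<bar>haar f - haar g\<bar> \<le> r"
proof -
  have "\<bar>haar f - haar g\<bar> \<le> haar (\<lambda>x. \<bar>f x - g x\<bar>)"
    unfolding haar_diff[OF assms(1,2), symmetric] by (intro haar_abs_le continuous_intros assms)
  also have "\<dots> \<le> haar (\<lambda>x. r)"
    by (intro haar_mono continuous_intros assms)
  finally show ?thesis by simp
qed

text \<open>By uniform continuity f exceeds f a / 2 on a ball around \<open>a\<close>. Finitely many
  left translates of \<open>f\<close> have a sum that is at least f a / 2 everywhere, and they all
  have the same integral.\<close>

lemma haar_pos: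
  assumes f: "continuous_on UNIV f" and nonneg: "\<And>x. 0 \<le> f x" and a: "0 < f a"
  shows "0 < haar f"
proof -
  from uniformly_continuous[OF f, of "f a / 2"] a obtain d where d: "0 < d"
    "\<And>x y. dist x y < d \<Longrightarrow> \<bar>f x - f y\<bar> < f a / 2" by auto
  from ex_min_net[OF compact_UNIV \<open>0 < d\<close>] obtain N :: "'a set" where N: "min_net d N" by blast
  have fin: "finite N" using N by (simp add: min_net_def)
  have cont: "continuous_on UNIV (\<lambda>x. f (g \<odot> x))" for g
    by (intro continuous_on_compose2[OF f] continuous_intros) auto
  have "f a / 2 = haar (\<lambda>x. f a / 2)" by simp
  also have "\<dots> \<le> haar (\<lambda>x. \<Sum>y\<in>N. f (a \<odot> ginv y \<odot> x))"
  proof (rule haar_mono)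
    fix x
    obtain y where y: "y \<in> N" "dist y x < d" using N unfolding min_net_def by blast
    have "dist a (a \<odot> ginv y \<odot> x) = dist y x"
      using dist_mul_left[of "a \<odot> ginv y" y x] by simp
    with d(2)[of a "a \<odot> ginv y \<odot> x"] y(2) have "f a / 2 \<le> f (a \<odot> ginv y \<odot> x)" by linarith
    also have "\<dots> \<le> (\<Sum>y\<in>N. f (a \<odot> ginv y \<odot> x))"
      using fin y(1) nonneg by (intro member_le_sum) auto
    finally show "f a / 2 \<le> (\<Sum>y\<in>N. f (a \<odot> ginv y \<odot> x))" .
  qed (intro continuous_intros cont)+
  also have "\<dots> = card N * haar f"
    by (simp add: haar_sum[OF cont] haar_left[OF f])
  finally have "0 < card N * haar f" using a by linarith
  then show ?thesis by (simp add: zero_less_mult_iff)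
qed

end

section \<open>Partitions of unity and iterated integrals\<close>

text \<open>Normalised tent functions over a net. They discretise one variable at three places: for
  total boundedness of equicontinuous families, for exchanging integrals, and for approximating
  densities by point masses.\<close>

lemma partition_of_unity:
  assumes "compact (UNIV :: 'a::metric_space set)" "0 < d"
  obtains N :: "'a::metric_space set" and p :: "'a \<Rightarrow> 'a \<Rightarrow> real"
  where "finite N" "\<And>a. continuous_on UNIV (p a)" "\<And>a x. 0 \<le> p a x"
    "\<And>x. (\<Sum>a\<in>N. p a x) = 1" "\<And>a x. p a x \<noteq> 0 \<Longrightarrow> dist a x < d"
proof -
  obtain N :: "'a set" where N: "finite N" "\<And>y. \<exists>x\<in>N. dist x y < d"
    using ex_min_net[OF assms] unfolding min_net_def by blast
  define h where "h a x = max 0 (d - dist a x)" for a x :: 'a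
  define p where "p a x = h a x / (\<Sum>b\<in>N. h b x)" for a x
  have h: "0 \<le> h a x" "h a x \<noteq> 0 \<Longrightarrow> dist a x < d" for a x
    by (auto simp: h_def split: if_splits)
  have pos: "0 < (\<Sum>b\<in>N. h b x)" for x
  proof -
    obtain b where b: "b \<in> N" "dist b x < d" using N(2) by blast
    then have "0 < h b x" by (simp add: h_def)
    also have "\<dots> \<le> (\<Sum>b\<in>N. h b x)" using N(1) b(1) h(1) by (intro member_le_sum) auto
    finally show ?thesis .
  qed
  have cont: "continuous_on UNIV (h a)" for a
    unfolding h_def[abs_def] by (intro continuous_intros)
  show thesis
  proof (rule that[of N p])
    show "continuous_on UNIV (p a)" for a
      unfolding p_def[abs_def] using pos by (intro continuous_intros cont) (simp add: less_imp_neq[symmetric])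
    show "0 \<le> p a x" for a x
      unfolding p_def using pos[of x] h(1) by simp
    show "(\<Sum>a\<in>N. p a x) = 1" for x
      unfolding p_def sum_divide_distrib[symmetric] using pos[of x] by simp
    show "dist a x < d" if "p a x \<noteq> 0" for a x
      using that h(2) unfolding p_def by fastforce
  qed (rule N(1))
qed

lemma partition_of_unity_approx:
  fixes p :: "'b \<Rightarrow> 'a \<Rightarrow> real"
  assumes "finite N" "\<And>a. 0 \<le> p a x" "(\<Sum>a\<in>N. p a x) = 1"
    and "\<And>a. a \<in> N \<Longrightarrow> p a x \<noteq> 0 \<Longrightarrow> \<bar>y - c a\<bar> \<le> r"
  shows "\<bar>y - (\<Sum>a\<in>N. p a x * c a)\<bar> \<le> r"
proof -
  have "y - (\<Sum>a\<in>N. p a x * c a) = (\<Sum>a\<in>N. p a x * (y - c a))"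
    using assms(3) by (simp add: right_diff_distrib sum_subtractf flip: sum_distrib_right)
  also have "\<bar>\<dots>\<bar> \<le> (\<Sum>a\<in>N. \<bar>p a x * (y - c a)\<bar>)" by (rule sum_abs)
  also have "\<dots> \<le> (\<Sum>a\<in>N. p a x * r)"
  proof (rule sum_mono)
    fix a assume "a \<in> N"
    then show "\<bar>p a x * (y - c a)\<bar> \<le> p a x * r"
      using assms(2)[of a] assms(4)[of a] by (cases "p a x = 0") (auto simp: abs_mult mult_left_mono)
  qed
  also have "\<dots> = r" using assms(3) by (simp flip: sum_distrib_right)
  finally show ?thesis .
qed

text \<open>The Arzela-Ascoli theorem by total boundedness: sample a function on a net, round the
  samples down to multiples of \<open>r\<close>, and glue them with a partition of unity. Finitely
  many glued functions arise.\<close>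

lemma compact_closure_equicontinuous:
  fixes F :: "('a::metric_space \<Rightarrow>\<^sub>C real) set"
  assumes compact: "compact (UNIV :: 'a set)"
    and bound: "\<And>f x. f \<in> F \<Longrightarrow> \<bar>apply_bcontfun f x\<bar> \<le> B"
    and equi: "\<And>r. 0 < r \<Longrightarrow> \<exists>d>0. \<forall>f\<in>F. \<forall>x y. dist x y < d \<longrightarrow> \<bar>apply_bcontfun f x - apply_bcontfun f y\<bar> \<le> r"
  shows "compact (closure F)"
proof -
  have net: "\<exists>K. finite K \<and> F \<subseteq> (\<Union>c\<in>K. cball c e)" if "0 < e" for e
  proof -
    \<comment> \<open>One \<open>r\<close> pays for the oscillation of the function at scale
      \<open>d\<close>, the other for rounding.\<close>
    define r where "r = e / 2"
    have r: "0 < r" using that by (simp add: r_def)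
    from equi[OF r] obtain d where d: "0 < d"
      "\<And>f x y. f \<in> F \<Longrightarrow> dist x y < d \<Longrightarrow> \<bar>apply_bcontfun f x - apply_bcontfun f y\<bar> \<le> r" by blast
    obtain N and p :: "'a \<Rightarrow> 'a \<Rightarrow> real" where N: "finite N" and cont: "\<And>a. continuous_on UNIV (p a)"
      and p: "\<And>a x. 0 \<le> p a x" "\<And>x. (\<Sum>a\<in>N. p a x) = 1" "\<And>a x. p a x \<noteq> 0 \<Longrightarrow> dist a x < d"
    proof (rule partition_of_unity[OF compact d(1)], goal_cases)
      case (1 N p)
      show ?case by (rule 1(1)[of N p, OF 1(2-)])
    qed
    \<comment> \<open>Values bounded by \<open>B\<close> have floors of f a / r between -m and m, so
      \<open>\<Sigma>\<close> is finite and contains every rounded sample.\<close>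
    define m where "m = \<lceil>B / r\<rceil>"
    define \<Sigma> where "\<Sigma> = (\<Pi>\<^sub>E a\<in>N. {-m..m})"
    define g where "g \<sigma> = Bcontfun (\<lambda>x. \<Sum>a\<in>N. p a x * (r * real_of_int (\<sigma> a)))" for \<sigma> :: "'a \<Rightarrow> int"
    have g: "apply_bcontfun (g \<sigma>) x = (\<Sum>a\<in>N. p a x * (r * real_of_int (\<sigma> a)))" for \<sigma> x
    proof -
      have c: "continuous_on UNIV (\<lambda>x. \<Sum>a\<in>N. p a x * (r * real_of_int (\<sigma> a)))"
        by (intro continuous_intros cont)
      have "bounded (range (\<lambda>x. \<Sum>a\<in>N. p a x * (r * real_of_int (\<sigma> a))))"
        by (rule compact_imp_bounded[OF compact_continuous_image[OF c compact]])
      then show ?thesis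
        unfolding g_def using c by (subst Bcontfun_inverse) (auto simp: bcontfun_def)
    qed
    have "F \<subseteq> (\<Union>c\<in>g ` \<Sigma>. cball c e)"
    proof
      fix f assume f: "f \<in> F"
      define \<sigma> where "\<sigma> = restrict (\<lambda>a. \<lfloor>apply_bcontfun f a / r\<rfloor>) N"
      have "\<sigma> \<in> \<Sigma>"
        unfolding \<Sigma>_def \<sigma>_def
      proof (rule restrict_PiE_iff[THEN iffD2], rule)
        fix a
        have "apply_bcontfun f a / r \<le> B / r" "- (B / r) \<le> apply_bcontfun f a / r"
          using bound[OF f, of a] r by (auto simp: field_simps abs_le_iff)
        then show "\<lfloor>apply_bcontfun f a / r\<rfloor> \<in> {-m..m}"
          unfolding m_def by (simp add: le_floor_iff floor_le_iff) linarith
      qed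
      moreover have "dist (g \<sigma>) f \<le> e"
      proof (rule dist_bound)
        fix x
        have "\<bar>apply_bcontfun f x - (\<Sum>a\<in>N. p a x * (r * real_of_int (\<sigma> a)))\<bar> \<le> 2 * r"
        proof (rule partition_of_unity_approx[OF N p(1,2)])
          fix a assume a: "a \<in> N" "p a x \<noteq> 0"
          have "\<bar>apply_bcontfun f a - apply_bcontfun f x\<bar> \<le> r" using d(2)[OF f p(3)[OF a(2)]] .
          moreover have "r * real_of_int (\<sigma> a) \<le> apply_bcontfun f a" "apply_bcontfun f a \<le> r * real_of_int (\<sigma> a) + r"
            using a(1) r mult_right_mono[OF of_int_floor_le[of "apply_bcontfun f a / r"], of r]
              mult_right_mono[OF real_of_int_floor_add_one_ge[of "apply_bcontfun f a / r"], of r]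
            by (simp_all add: \<sigma>_def algebra_simps)
          ultimately show "\<bar>apply_bcontfun f x - r * real_of_int (\<sigma> a)\<bar> \<le> 2 * r" by linarith
        qed
        then show "dist (apply_bcontfun (g \<sigma>) x) (apply_bcontfun f x) \<le> e"
          by (simp add: g dist_real_def r_def abs_minus_commute)
      qed
      ultimately show "f \<in> (\<Union>c\<in>g ` \<Sigma>. cball c e)" by auto
    qed
    moreover have "finite (g ` \<Sigma>)" unfolding \<Sigma>_def by (intro finite_imageI finite_PiE N) simp
    ultimately show ?thesis by blast
  qed
  show ?thesis
    unfolding compact_eq_totally_bounded complete_eq_closed
  proof (intro conjI allI impI closed_closure)
    fix e :: real assume e: "0 < e"
    with net[of "e / 2"] obtain K where K: "finite K" "F \<subseteq> (\<Union>c\<in>K. cball c (e / 2))" by auto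
    have "closure F \<subseteq> (\<Union>c\<in>K. cball c (e / 2))"
      by (rule closure_minimal[OF K(2)]) (intro closed_UN K closed_cball ballI)
    also have "\<dots> \<subseteq> (\<Union>c\<in>K. ball c e)" using e by force
    finally show "\<exists>k. finite k \<and> closure F \<subseteq> (\<Union>x\<in>k. ball x e)" using K(1) by blast
  qed
qed

section \<open>Iterated Haar integrals\<close>

context compact_metric_group
begin

lemma uniformly_continuous_left:
  fixes F :: "'a \<Rightarrow> 'a \<Rightarrow> real"
  assumes "continuous_on UNIV (\<lambda>(x, y). F x y)" "0 < r"
  obtains d where "0 < d" "\<And>x x' y. dist x x' < d \<Longrightarrow> \<bar>F x y - F x' y\<bar> < r"
proof -
  have "compact (UNIV :: ('a \<times> 'a) set)"
    unfolding UNIV_Times_UNIV[symmetric] by (intro compact_Times compact_UNIV)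
  from compact_uniformly_continuous[OF assms(1) this] assms(2) obtain d where "0 < d"
    "\<And>x y. dist x y < d \<Longrightarrow> dist (case x of (x, y) \<Rightarrow> F x y) (case y of (x, y) \<Rightarrow> F x y) < r"
    unfolding uniformly_continuous_on_def by (metis UNIV_I)
  from this(2)[of "(_, _)" "(_, _)"] \<open>0 < d\<close> show thesis
    by (intro that[of d]) (auto simp: dist_Pair_Pair dist_real_def)
qed

lemma continuous_on_section:
  assumes "continuous_on UNIV (\<lambda>(x, y). F x y)"
  shows "continuous_on UNIV (F x)" "continuous_on UNIV (\<lambda>x. F x y)"
  using continuous_on_compose2[OF assms, of UNIV "\<lambda>y. (x, y)"]
    continuous_on_compose2[OF assms, of UNIV "\<lambda>x. (x, y)"]
  by (simp_all add: continuous_on_Pair continuous_on_const continuous_on_id)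

lemma continuous_on_haar:
  fixes F :: "'a \<Rightarrow> 'a \<Rightarrow> real"
  assumes F: "continuous_on UNIV (\<lambda>(x, y). F x y)"
  shows "continuous_on UNIV (\<lambda>x. haar (F x))"
  unfolding continuous_on_iff
proof (intro ballI allI impI)
  fix x e assume "(0::real) < e"
  then have "0 < e / 2" by simp
  from uniformly_continuous_left[OF F this] obtain d where d: "0 < d"
    "\<And>x x' y. dist x x' < d \<Longrightarrow> \<bar>F x y - F x' y\<bar> < e / 2" by blast
  show "\<exists>d>0. \<forall>x'\<in>UNIV. dist x' x < d \<longrightarrow> dist (haar (F x')) (haar (F x)) < e"
  proof (intro exI[of _ d] conjI ballI impI d(1))
    fix x' assume "dist x' x < d"
    then have "\<bar>haar (F x') - haar (F x)\<bar> \<le> e / 2"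
      by (intro haar_close continuous_on_section[OF F] less_imp_le d(2))
    with \<open>0 < e\<close> show "dist (haar (F x')) (haar (F x)) < e" by (simp add: dist_real_def)
  qed
qed

lemma continuous_on_flip:
  assumes "continuous_on UNIV (\<lambda>(x, y). F x y)"
  shows "continuous_on UNIV (\<lambda>(y, x). F x y)"
  using continuous_on_compose2[OF assms continuous_on_swap[of UNIV]]
  by (simp add: prod.swap_def case_prod_beta)

text \<open>Up to a uniform error, F x y is the finite sum of the products p a x * F a y, and for
  such a sum both iterated integrals are visibly equal.\<close>

lemma haar_swap:
  fixes F :: "'a \<Rightarrow> 'a \<Rightarrow> real"
  assumes F: "continuous_on UNIV (\<lambda>(x, y). F x y)"
  shows "haar (\<lambda>x. haar (\<lambda>y. F x y)) = haar (\<lambda>y. haar (\<lambda>x. F x y))"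
proof -
  have "\<bar>haar (\<lambda>x. haar (F x)) - haar (\<lambda>y. haar (\<lambda>x. F x y))\<bar> \<le> e" if "0 < e" for e
  proof -
    from that have "0 < e / 2" by simp
    from uniformly_continuous_left[OF F this] obtain d where d: "0 < d"
      "\<And>x x' y. dist x x' < d \<Longrightarrow> \<bar>F x y - F x' y\<bar> < e / 2" by blast
    obtain N and p :: "'a \<Rightarrow> 'a \<Rightarrow> real" where N: "finite N" and cont: "\<And>a. continuous_on UNIV (p a)"
      and p: "\<And>a x. 0 \<le> p a x" "\<And>x. (\<Sum>a\<in>N. p a x) = 1" "\<And>a x. p a x \<noteq> 0 \<Longrightarrow> dist a x < d"
    proof (rule partition_of_unity[OF compact_UNIV d(1)], goal_cases)
      case (1 N p)
      show ?case by (rule 1(1)[of N p, OF 1(2-)])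
    qed
    have approx: "\<bar>F x y - (\<Sum>a\<in>N. p a x * F a y)\<bar> \<le> e / 2" for x y
      using p(3) d(2) by (intro partition_of_unity_approx[OF N p(1,2)]) (simp add: dist_commute less_imp_le)
    note cF = continuous_on_section[OF F]
    have 1: "haar (\<lambda>x. \<Sum>a\<in>N. p a x * c a) = (\<Sum>a\<in>N. haar (p a) * c a)" for c
      by (subst haar_sum) (auto simp: haar_cmult cont mult.commute[of _ "c _"] intro!: continuous_intros)
    have 2: "haar (\<lambda>y. \<Sum>a\<in>N. c a * F a y) = (\<Sum>a\<in>N. c a * haar (F a))" for c
      by (subst haar_sum) (auto simp: haar_cmult cF intro!: continuous_intros cF)
    have "\<bar>haar (\<lambda>x. haar (F x)) - haar (\<lambda>x. \<Sum>a\<in>N. p a x * haar (F a))\<bar> \<le> e / 2"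
    proof (rule haar_close)
      fix x
      show "\<bar>haar (F x) - (\<Sum>a\<in>N. p a x * haar (F a))\<bar> \<le> e / 2"
        unfolding 2[symmetric] by (intro haar_close approx cF continuous_intros)
    qed (intro continuous_on_haar[OF F] continuous_intros cont)+
    moreover have "\<bar>haar (\<lambda>y. haar (\<lambda>x. F x y)) - haar (\<lambda>y. \<Sum>a\<in>N. haar (p a) * F a y)\<bar> \<le> e / 2"
    proof (rule haar_close)
      fix y
      show "\<bar>haar (\<lambda>x. F x y) - (\<Sum>a\<in>N. haar (p a) * F a y)\<bar> \<le> e / 2"
        unfolding 1[symmetric] by (intro haar_close approx cF continuous_intros cont)
      show "continuous_on UNIV (\<lambda>y. haar (\<lambda>x. F x y))"
        by (rule continuous_on_haar[OF continuous_on_flip[OF F]])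
    qed (intro cF continuous_intros)+
    ultimately show ?thesis unfolding 1 2 by linarith
  qed
  from field_le_epsilon[of "\<bar>haar (\<lambda>x. haar (F x)) - haar (\<lambda>y. haar (\<lambda>x. F x y))\<bar>" 0] this
  show ?thesis by simp
qed

end

section \<open>Spectral truncation of symmetric compact operators\<close>

text \<open>Two norms live on \<open>'e\<close>: its own, and the weaker one given by
  \<open>ip\<close>, for which completeness is not assumed. \<open>A_compact\<close> maps the weak
  unit ball into a strongly compact set, so limits of images under \<open>A\<close> exist without a
  Hilbert space completion. The intended model is C(G) with the sup norm, the L2 product and a
  convolution operator.\<close>

locale symmetric_compact_operator =
  fixes ip :: "'e::real_normed_vector \<Rightarrow> 'e \<Rightarrow> real" and A :: "'e \<Rightarrow> 'e"
  assumes ip_add_left: "ip (x + y) z = ip x z + ip y z"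
    and ip_scaleR_left: "ip (r *\<^sub>R x) y = r * ip x y"
    and ip_commute: "ip x y = ip y x"
    and ip_pos: "x \<noteq> 0 \<Longrightarrow> 0 < ip x x"
    and ip_le_norm: "ip x x \<le> (norm x)\<^sup>2"
    and linear_A: "linear A"
    and A_symmetric: "ip (A x) y = ip x (A y)"
    and A_compact: "\<exists>K. compact K \<and> (\<forall>x. ip x x \<le> 1 \<longrightarrow> A x \<in> K)"
begin

lemma ip_add_right: "ip x (y + z) = ip x y + ip x z"
  using ip_add_left by (simp add: ip_commute)

lemma ip_scaleR_right: "ip x (r *\<^sub>R y) = r * ip x y"
  using ip_scaleR_left by (simp add: ip_commute)

lemma linear_ip_left: "linear (\<lambda>x. ip x y)"
  by (simp add: linear_iff ip_add_left ip_scaleR_left)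

lemma ip_simps [simp]: "ip 0 y = 0" "ip x 0 = 0"
  using linear_0[OF linear_ip_left[of y]] linear_0[OF linear_ip_left[of x]] ip_commute[of x 0] by simp_all

lemma ip_diff_left: "ip (x - y) z = ip x z - ip y z"
  by (rule linear_diff[OF linear_ip_left])

lemma ip_diff_right: "ip x (y - z) = ip x y - ip x z"
  using ip_diff_left by (simp add: ip_commute)

lemma ip_sum_left: "ip (\<Sum>i\<in>S. f i) y = (\<Sum>i\<in>S. ip (f i) y)"
  by (rule linear_sum[OF linear_ip_left])

lemma ip_nonneg: "0 \<le> ip x x"
  using ip_pos[of x] by (cases "x = 0") auto

lemma ip_Cauchy_Schwarz: "\<bar>ip x y\<bar> \<le> sqrt (ip x x) * sqrt (ip y y)"
proof (cases "y = 0")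
  case False
  then have y: "0 < ip y y" by (rule ip_pos)
  let ?t = "ip x y / ip y y"
  have "0 \<le> ip (x - ?t *\<^sub>R y) (x - ?t *\<^sub>R y)" by (rule ip_nonneg)
  also have "\<dots> = ip x x - (ip x y)\<^sup>2 / ip y y"
    using y by (simp add: ip_diff_left ip_diff_right ip_scaleR_left ip_scaleR_right ip_commute[of y x]
        power2_eq_square)
  finally have "(ip x y)\<^sup>2 \<le> ip x x * ip y y"
    using y by (simp add: field_simps)
  then have "sqrt ((ip x y)\<^sup>2) \<le> sqrt (ip x x * ip y y)" by (rule real_sqrt_le_mono)
  then show ?thesis by (simp add: real_sqrt_mult)
qed simp

lemma bounded_bilinear_ip: "bounded_bilinear ip"
proof
  show "\<exists>K. \<forall>x y. norm (ip x y) \<le> norm x * norm y * K"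
  proof (intro exI[of _ 1] allI)
    fix x y
    have "sqrt (ip x x) \<le> norm x" for x using ip_le_norm by (simp add: real_le_lsqrt)
    then have "sqrt (ip x x) * sqrt (ip y y) \<le> norm x * norm y"
      by (intro mult_mono) (simp_all add: ip_nonneg)
    with ip_Cauchy_Schwarz[of x y] show "norm (ip x y) \<le> norm x * norm y * 1" by simp
  qed
qed (simp_all add: ip_add_left ip_add_right ip_scaleR_left ip_scaleR_right)

lemmas tendsto_ip = bounded_bilinear.tendsto[OF bounded_bilinear_ip]

text \<open>Boundedness from the weak norm to the strong one: after one application of
  \<open>A\<close>, smallness for \<open>ip\<close> becomes smallness in norm.\<close>

lemma A_bound: "\<exists>M. \<forall>x. norm (A x) \<le> M * sqrt (ip x x)"
proof -
  obtain K where K: "compact K" "\<And>x. ip x x \<le> 1 \<Longrightarrow> A x \<in> K" using A_compact by blast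
  then obtain M where M: "\<And>x. ip x x \<le> 1 \<Longrightarrow> norm (A x) \<le> M"
    using compact_imp_bounded[OF K(1)] unfolding bounded_iff by blast
  show ?thesis
  proof (intro exI[of _ M] allI)
    fix x
    show "norm (A x) \<le> M * sqrt (ip x x)"
    proof (cases "x = 0")
      case True
      then show ?thesis by (simp add: linear_0[OF linear_A])
    next
      case False
      let ?s = "sqrt (ip x x)"
      have s: "0 < ?s" using ip_pos[OF False] by simp
      have "ip ((1 / ?s) *\<^sub>R x) ((1 / ?s) *\<^sub>R x) = 1"
        using s ip_nonneg[of x] by (simp add: ip_scaleR_left ip_scaleR_right)
      then have "norm (A ((1 / ?s) *\<^sub>R x)) \<le> M" by (intro M) simp
      then show ?thesis using s by (simp add: linear_scale[OF linear_A] field_simps)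
    qed
  qed
qed

lemma bounded_linear_A: "bounded_linear A"
proof -
  obtain M where M: "\<And>x. norm (A x) \<le> M * sqrt (ip x x)" using A_bound by blast
  show ?thesis
  proof (rule bounded_linear_intro)
    fix x
    have "norm (A x) \<le> \<bar>M\<bar> * sqrt (ip x x)"
      using M[of x] by (rule order_trans) (simp add: mult_right_mono ip_nonneg)
    also have "\<dots> \<le> \<bar>M\<bar> * norm x"
      using ip_le_norm by (intro mult_left_mono real_le_lsqrt) auto
    finally show "norm (A x) \<le> norm x * \<bar>M\<bar>" by (simp add: mult.commute)
  qed (simp_all add: linear_add[OF linear_A] linear_scale[OF linear_A])
qed

lemmas tendsto_A = bounded_linear.tendsto[OF bounded_linear_A]

text \<open>A union of eigenspaces rather than their span, so membership passes to any
  transformation that commutes with \<open>A\<close>, such as a right translation.\<close>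

definition eigen :: "real \<Rightarrow> 'e set"
  where "eigen c = {x. \<exists>l. c \<le> \<bar>l\<bar> \<and> A x = l *\<^sub>R x}"

definition eigen_orthonormal :: "real \<Rightarrow> 'e set \<Rightarrow> bool"
  where "eigen_orthonormal c B \<longleftrightarrow> B \<subseteq> eigen c \<and> (\<forall>x\<in>B. \<forall>y\<in>B. ip x y = (if x = y then 1 else 0))"

text \<open>The images of two distinct members are orthogonal of length at least c, so their
  distance is at least c even for the weaker \<open>ip\<close> norm. An infinite set would thus give
  a sequence in a compact set without Cauchy subsequence.\<close>

lemma eigen_orthonormal_finite:
  assumes B: "eigen_orthonormal c B" and c: "0 < c"
  shows "finite B"
proof (rule ccontr)
  assume "infinite B"
  then obtain e :: "nat \<Rightarrow> 'e" where e: "inj e" "range e \<subseteq> B"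
    using infinite_countable_subset by blast
  have ip_e: "ip (e m) (e n) = (if m = n then 1 else 0)" for m n
    using B e unfolding eigen_orthonormal_def inj_def by (auto simp: subset_iff)
  have "\<forall>n. \<exists>l. c \<le> \<bar>l\<bar> \<and> A (e n) = l *\<^sub>R e n"
    using B e unfolding eigen_orthonormal_def eigen_def by blast
  then obtain l where l: "\<And>n. c \<le> \<bar>l n\<bar>" "\<And>n. A (e n) = l n *\<^sub>R e n" by metis
  obtain K where K: "compact K" "\<And>x. ip x x \<le> 1 \<Longrightarrow> A x \<in> K" using A_compact by blast
  have "\<forall>n. A (e n) \<in> K" using ip_e by (intro allI K(2)) simp
  then obtain y r where r: "strict_mono (r :: nat \<Rightarrow> nat)" "((\<lambda>n. A (e n)) \<circ> r) \<longlonglongrightarrow> y"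
    using K(1)[unfolded compact_def, THEN spec, of "\<lambda>n. A (e n)"] by blast
  have "Cauchy ((\<lambda>n. A (e n)) \<circ> r)" using r(2) by (rule LIMSEQ_imp_Cauchy)
  from metric_CauchyD[OF this c] obtain M where
    "\<And>m n. m \<ge> M \<Longrightarrow> n \<ge> M \<Longrightarrow> dist (A (e (r m))) (A (e (r n))) < c" by auto
  then have "norm (A (e (r M)) - A (e (r (Suc M)))) < c" (is "norm ?d < c") by (simp add: dist_norm)
  then have "(norm ?d)\<^sup>2 < c\<^sup>2" using c by (intro power_strict_mono) auto
  have "r M \<noteq> r (Suc M)" using strict_monoD[OF r(1), of M "Suc M"] by simp
  then have "ip ?d ?d = (l (r M))\<^sup>2 + (l (r (Suc M)))\<^sup>2"
    by (simp add: l ip_diff_left ip_diff_right ip_scaleR_left ip_scaleR_right ip_e power2_eq_square)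
  moreover have "c\<^sup>2 \<le> (l (r M))\<^sup>2"
    using power_mono[OF l(1), of 2 "r M"] c by simp
  moreover have "0 \<le> (l (r (Suc M)))\<^sup>2" by simp
  ultimately have "c\<^sup>2 \<le> ip ?d ?d" by linarith
  with ip_le_norm[of ?d] \<open>(norm ?d)\<^sup>2 < c\<^sup>2\<close> show False by linarith
qed

lemma ex_maximal_eigen_orthonormal:
  "\<exists>B. eigen_orthonormal c B \<and> (\<forall>B'. eigen_orthonormal c B' \<longrightarrow> B \<subseteq> B' \<longrightarrow> B' = B)"
proof -
  have "\<exists>B\<in>{B. eigen_orthonormal c B}. \<forall>B'\<in>{B. eigen_orthonormal c B}. B \<subseteq> B' \<longrightarrow> B' = B"
  proof (rule subset_Zorn')
    fix C assume C: "subset.chain {B. eigen_orthonormal c B} C"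
    have "ip x y = (if x = y then 1 else 0)" if xy: "x \<in> \<Union>C" "y \<in> \<Union>C" for x y
    proof -
      obtain X Y where XY: "X \<in> C" "x \<in> X" "Y \<in> C" "y \<in> Y" using xy by (meson UnionE)
      then have "X \<subseteq> Y \<or> Y \<subseteq> X" using C unfolding subset_chain_def by blast
      then obtain Z where "Z \<in> C" "x \<in> Z" "y \<in> Z" using XY by blast
      then show ?thesis using C unfolding subset_chain_def eigen_orthonormal_def by blast
    qed
    moreover have "\<Union>C \<subseteq> eigen c" using C unfolding subset_chain_def eigen_orthonormal_def by blast
    ultimately show "\<Union>C \<in> {B. eigen_orthonormal c B}" unfolding eigen_orthonormal_def by blast
  qed
  then show ?thesis by blast
qed

lemma ip_projection:
  assumes "finite B" "eigen_orthonormal c B" "e \<in> B"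
  shows "ip (\<Sum>b\<in>B. ip x b *\<^sub>R b) e = ip x e"
proof -
  have "ip (\<Sum>b\<in>B. ip x b *\<^sub>R b) e = (\<Sum>b\<in>B. if b = e then ip x e else 0)"
    unfolding ip_sum_left ip_scaleR_left
    using assms(2,3) by (intro sum.cong refl) (simp add: eigen_orthonormal_def)
  also have "\<dots> = ip x e" using assms(1,3) by simp
  finally show ?thesis .
qed

text \<open>By symmetry, the coefficient of \<open>x\<close> at \<open>b\<close> vanishes unless
  \<open>x\<close> and \<open>b\<close> belong to the same eigenvalue. Hence the remainder of
  \<open>x\<close> after projection is still in the eigenspace of \<open>x\<close>; if nonzero, its
  normalisation would enlarge the maximal set \<open>B\<close>.\<close>

lemma eigen_expansion:
  assumes B: "finite B" "eigen_orthonormal c B"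
    and max: "\<And>B'. eigen_orthonormal c B' \<Longrightarrow> B \<subseteq> B' \<Longrightarrow> B' = B"
    and x: "x \<in> eigen c"
  shows "x = (\<Sum>b\<in>B. ip x b *\<^sub>R b)"
proof (rule ccontr)
  assume ne: "\<not> ?thesis"
  define u where "u = x - (\<Sum>b\<in>B. ip x b *\<^sub>R b)"
  have u: "u \<noteq> 0" using ne by (simp add: u_def)
  obtain l where l: "c \<le> \<bar>l\<bar>" "A x = l *\<^sub>R x" using x unfolding eigen_def by blast
  have "A (\<Sum>b\<in>B. ip x b *\<^sub>R b) = (\<Sum>b\<in>B. ip x b *\<^sub>R A b)"
    by (simp add: linear_sum[OF linear_A] linear_scale[OF linear_A])
  also have "\<dots> = (\<Sum>b\<in>B. l *\<^sub>R ip x b *\<^sub>R b)"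
  proof (rule sum.cong[OF refl])
    fix b assume "b \<in> B"
    then obtain k where k: "A b = k *\<^sub>R b" using B(2) unfolding eigen_orthonormal_def eigen_def by blast
    have "l * ip x b = k * ip x b"
      using A_symmetric[of x b] by (simp add: l k ip_scaleR_left ip_scaleR_right)
    then show "ip x b *\<^sub>R A b = l *\<^sub>R ip x b *\<^sub>R b" unfolding k scaleR_scaleR by (simp only: mult.commute)
  qed
  finally have Au: "A u = l *\<^sub>R u"
    by (simp add: u_def linear_diff[OF linear_A] l scaleR_right_diff_distrib scaleR_right.sum)
  have orth: "ip u b = 0" if "b \<in> B" for b
    using ip_projection[OF B that] by (simp add: u_def ip_diff_left)
  define v where "v = (1 / sqrt (ip u u)) *\<^sub>R u"
  have v1: "ip v v = 1"
    using ip_pos[OF u] by (simp add: v_def ip_scaleR_left ip_scaleR_right)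
  have v0: "ip v b = 0" "ip b v = 0" if "b \<in> B" for b
    using orth[OF that] by (simp_all add: v_def ip_scaleR_left ip_commute[of b])
  have "v \<in> eigen c"
    using l(1) Au unfolding eigen_def v_def by (auto simp: linear_scale[OF linear_A] mult.commute)
  then have "eigen_orthonormal c (insert v B)"
    using B(2) v0 v1 unfolding eigen_orthonormal_def by force
  then have "insert v B = B" by (rule max) blast
  with v0(1)[of v] v1 show False by auto
qed

text \<open>The variational argument on the orthogonal complement \<open>W\<close> of
  \<open>B\<close>. If the supremum \<open>s\<close> of q on the unit ball of \<open>W\<close>
  exceeded c^2, the images of a maximising sequence would accumulate at a nonzero y in
  \<open>W\<close> with A (A y) = s y. This produces an eigenvector in \<open>W\<close> for sqrt s
  or -sqrt s, against the maximality of \<open>B\<close>.\<close>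

lemma eigen_orthogonal_bound:
  assumes B: "finite B" "eigen_orthonormal c B"
    and max: "\<And>B'. eigen_orthonormal c B' \<Longrightarrow> B \<subseteq> B' \<Longrightarrow> B' = B"
    and c: "0 < c" and x: "\<And>b. b \<in> B \<Longrightarrow> ip x b = 0"
  shows "ip (A x) (A x) \<le> c\<^sup>2 * ip x x"
proof (rule ccontr)
  assume contra: "\<not> ?thesis"
  define W where "W = {x. \<forall>b\<in>B. ip x b = 0}"
  define q where "q x = ip (A x) (A x)" for x
  have W_A: "A w \<in> W" if "w \<in> W" for w
    using that B(2) unfolding W_def eigen_orthonormal_def eigen_def
    by (force simp: A_symmetric ip_scaleR_right)
  have W_scale: "r *\<^sub>R w \<in> W" if "w \<in> W" for w r
    using that unfolding W_def by (simp add: ip_scaleR_left)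
  have W_add: "w + w' \<in> W" if "w \<in> W" "w' \<in> W" for w w'
    using that unfolding W_def by (simp add: ip_add_left)
  have W_eigen: "w = 0" if "w \<in> W" "w \<in> eigen c" for w
    using eigen_expansion[OF B max that(2)] that(1) unfolding W_def by simp
  obtain M where M: "\<And>x. norm (A x) \<le> M * sqrt (ip x x)" using A_bound by blast
  have q_scale: "q (r *\<^sub>R w) = r\<^sup>2 * q w" for r w
    by (simp add: q_def linear_scale[OF linear_A] ip_scaleR_left ip_scaleR_right power2_eq_square)
  have q_bound: "q w \<le> M\<^sup>2 * ip w w" for w
  proof -
    have "q w \<le> (norm (A w))\<^sup>2" unfolding q_def by (rule ip_le_norm)
    also have "\<dots> \<le> (M * sqrt (ip w w))\<^sup>2" using M[of w] by (intro power_mono) auto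
    finally show ?thesis by (simp add: power_mult_distrib ip_nonneg)
  qed
  define Q where "Q = q ` {w \<in> W. ip w w \<le> 1}"
  have bdd: "bdd_above Q"
  proof (rule bdd_aboveI)
    fix t assume "t \<in> Q"
    then obtain w where w: "ip w w \<le> 1" "t = q w" unfolding Q_def by blast
    have "M\<^sup>2 * ip w w \<le> M\<^sup>2 * 1" by (intro mult_left_mono w) simp
    with q_bound[of w] w(2) show "t \<le> M\<^sup>2" by simp
  qed
  define s where "s = Sup Q"
  have q_le: "q w \<le> s * ip w w" if "w \<in> W" for w
  proof (cases "w = 0")
    case False
    let ?t = "1 / sqrt (ip w w)"
    have ipw: "0 < ip w w" by (rule ip_pos[OF False])
    have "?t\<^sup>2 = 1 / ip w w" using ipw by (simp add: power_divide)
    moreover have "q (?t *\<^sub>R w) \<le> s"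
      unfolding s_def Q_def using that bdd ipw
      by (intro cSup_upper imageI) (auto simp: Q_def W_scale ip_scaleR_left ip_scaleR_right)
    ultimately show ?thesis using ipw by (simp add: q_scale field_simps)
  qed (simp add: q_def linear_0[OF linear_A])
  have xW: "x \<in> W" using x by (simp add: W_def)
  have x_pos: "0 < ip x x" using contra ip_pos[of x] by (cases "x = 0") (auto simp: linear_0[OF linear_A])
  have "c\<^sup>2 * ip x x < s * ip x x" using contra q_le[OF xW] unfolding q_def by linarith
  then have s: "c\<^sup>2 < s" using x_pos by simp
  then have s_pos: "0 < s" using zero_le_power2[of c] by linarith
  have "Q \<noteq> {}" unfolding Q_def W_def by (auto intro: exI[of _ 0])
  have "\<exists>w. w \<in> W \<and> ip w w \<le> 1 \<and> s - inverse (Suc n) < q w" for n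
    using less_cSup_iff[OF \<open>Q \<noteq> {}\<close> bdd, of "s - inverse (Suc n)"] unfolding s_def Q_def by auto
  then obtain w where w: "\<And>n. w n \<in> W" "\<And>n. ip (w n) (w n) \<le> 1" "\<And>n. s - inverse (Suc n) < q (w n)"
    by metis
  obtain K where K: "compact K" "\<And>x. ip x x \<le> 1 \<Longrightarrow> A x \<in> K" using A_compact by blast
  have "\<forall>n. A (w n) \<in> K" using w(2) K(2) by blast
  then obtain y r where r: "strict_mono (r :: nat \<Rightarrow> nat)" "((\<lambda>n. A (w n)) \<circ> r) \<longlonglongrightarrow> y"
    using K(1)[unfolded compact_def, THEN spec, of "\<lambda>n. A (w n)"] by blast
  have Aw: "(\<lambda>n. A (w (r n))) \<longlonglongrightarrow> y" using r(2) by (simp add: o_def)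
  have "(\<lambda>n. q (w n)) \<longlonglongrightarrow> s"
  proof (rule tendsto_sandwich[of "\<lambda>n. s - inverse (Suc n)" _ _ "\<lambda>n. s"])
    show "\<forall>\<^sub>F n in sequentially. s - inverse (real (Suc n)) \<le> q (w n)"
      using w(3) by (intro always_eventually allI less_imp_le)
    show "\<forall>\<^sub>F n in sequentially. q (w n) \<le> s"
    proof (intro always_eventually allI)
      fix n
      have "s * ip (w n) (w n) \<le> s * 1" using s_pos w(2) by (intro mult_left_mono) auto
      with q_le[OF w(1)[of n]] show "q (w n) \<le> s" by linarith
    qed
    show "(\<lambda>n. s - inverse (real (Suc n))) \<longlonglongrightarrow> s"
      using tendsto_diff[OF tendsto_const LIMSEQ_inverse_real_of_nat, of s] by simp
  qed simp
  then have qw: "(\<lambda>n. q (w (r n))) \<longlonglongrightarrow> s"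
    using LIMSEQ_subseq_LIMSEQ[OF _ r(1)] by (fastforce simp: o_def)
  have "ip y y = s"
    using tendsto_ip[OF Aw Aw] qw unfolding q_def by (rule LIMSEQ_unique)
  then have y: "y \<noteq> 0" using s_pos by auto
  have yW: "y \<in> W"
    unfolding W_def
  proof safe
    fix b assume "b \<in> B"
    then have "(\<lambda>n. ip (A (w (r n))) b) = (\<lambda>n. 0)" using W_A[OF w(1)] unfolding W_def by auto
    with tendsto_ip[OF Aw tendsto_const, of b] have "(\<lambda>n. 0) \<longlonglongrightarrow> ip y b" by simp
    then show "ip y b = 0" by (simp add: LIMSEQ_const_iff)
  qed
  \<comment> \<open>The defect in the eigenvalue equation for the square of \<open>A\<close>. Its
    \<open>ip\<close> length tends to 0 because q (A w) \<le> s * q w and ip w w \<le> 1 bound its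
    square by s * q w - 2 * s * q w + s^2.\<close>
  define z where "z n = A (A (w (r n))) - s *\<^sub>R w (r n)" for n
  have ip_z: "ip (z n) (z n) \<le> s * (s - q (w (r n)))" for n
  proof -
    let ?w = "w (r n)"
    have 1: "ip (A (A ?w)) ?w = q ?w" unfolding q_def by (rule A_symmetric)
    have 2: "ip ?w (A (A ?w)) = q ?w" using 1 by (simp only: ip_commute[of ?w "A (A ?w)"])
    have "ip (z n) (z n) = q (A ?w) - 2 * s * q ?w + s * s * ip ?w ?w"
      unfolding z_def ip_diff_left ip_diff_right ip_scaleR_left ip_scaleR_right 1 2 q_def[of "A ?w"]
      by (simp add: algebra_simps)
    also have "q (A ?w) \<le> s * q ?w" using q_le[OF W_A[OF w(1)]] unfolding q_def .
    also have "s * s * ip ?w ?w \<le> s * s * 1" using w(2) s_pos by (intro mult_left_mono) auto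
    finally show ?thesis by (simp add: algebra_simps)
  qed
  \<comment> \<open>The vectors \<open>w (r n)\<close> need not converge, only their images do.
    Applying \<open>A\<close> once more makes the defect small in norm and expresses it through
    these images alone.\<close>
  have "(\<lambda>n. \<bar>M\<bar> * sqrt (s * (s - q (w (r n))))) \<longlonglongrightarrow> \<bar>M\<bar> * sqrt (s * (s - s))"
    by (intro tendsto_intros qw)
  moreover have "norm (A (z n)) \<le> \<bar>M\<bar> * sqrt (s * (s - q (w (r n))))" for n
  proof -
    have "norm (A (z n)) \<le> \<bar>M\<bar> * sqrt (ip (z n) (z n))"
      using M[of "z n"] by (rule order_trans) (simp add: mult_right_mono ip_nonneg)
    also have "\<dots> \<le> \<bar>M\<bar> * sqrt (s * (s - q (w (r n))))"
      using ip_z by (intro mult_left_mono real_sqrt_le_mono) auto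
    finally show ?thesis .
  qed
  ultimately have "(\<lambda>n. A (z n)) \<longlonglongrightarrow> 0"
    by (intro Lim_null_comparison[of "\<lambda>n. A (z n)" "\<lambda>n. \<bar>M\<bar> * sqrt (s * (s - q (w (r n))))"]) auto
  moreover have "(\<lambda>n. A (z n)) \<longlonglongrightarrow> A (A y) - s *\<^sub>R y"
    unfolding z_def linear_diff[OF linear_A] linear_scale[OF linear_A]
    by (intro tendsto_intros tendsto_A Aw)
  ultimately have "A (A y) - s *\<^sub>R y = 0" by (rule LIMSEQ_unique[symmetric])
  \<comment> \<open>The operator A^2 - s factors as (A - sqrt s)(A + sqrt s). So A y + sqrt s y lies
    in the eigenspace of sqrt s; it must vanish, and then \<open>y\<close> itself is an eigenvector
    for -sqrt s.\<close>
  then have AAy: "A (A y) = sqrt s *\<^sub>R sqrt s *\<^sub>R y" using s_pos by simp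
  have cs: "c \<le> \<bar>sqrt s\<bar>" using s s_pos c by (simp add: real_le_rsqrt)
  have "A (A y + sqrt s *\<^sub>R y) = sqrt s *\<^sub>R (A y + sqrt s *\<^sub>R y)"
    by (simp add: linear_add[OF linear_A] linear_scale[OF linear_A] AAy scaleR_right_distrib add.commute
        del: scaleR_scaleR)
  then have "A y + sqrt s *\<^sub>R y \<in> eigen c" unfolding eigen_def using cs by blast
  then have "A y + sqrt s *\<^sub>R y = 0" by (intro W_eigen W_add W_A W_scale yW)
  then have "A y = (- sqrt s) *\<^sub>R y" by (simp add: eq_neg_iff_add_eq_0)
  then have "y \<in> eigen c" unfolding eigen_def using cs by (auto intro!: exI[of _ "- sqrt s"])
  with W_eigen[OF yW] y show False by blast
qed

lemma spectral_truncation: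
  assumes "0 < c"
  obtains B where "finite B" "B \<subseteq> eigen c"
    "\<And>x y. x \<in> B \<Longrightarrow> y \<in> B \<Longrightarrow> ip x y = (if x = y then 1 else 0)"
    "\<And>x. x \<in> eigen c \<Longrightarrow> x = (\<Sum>b\<in>B. ip x b *\<^sub>R b)"
    "\<And>x. (\<And>b. b \<in> B \<Longrightarrow> ip x b = 0) \<Longrightarrow> ip (A x) (A x) \<le> c\<^sup>2 * ip x x"
proof -
  obtain B where B: "eigen_orthonormal c B"
    and max: "\<And>B'. eigen_orthonormal c B' \<Longrightarrow> B \<subseteq> B' \<Longrightarrow> B' = B"
    using ex_maximal_eigen_orthonormal by blast
  have fin: "finite B" by (rule eigen_orthonormal_finite[OF B assms])
  show thesis
  proof (rule that[OF fin])
    show "B \<subseteq> eigen c" "\<And>x y. x \<in> B \<Longrightarrow> y \<in> B \<Longrightarrow> ip x y = (if x = y then 1 else 0)"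
      using B unfolding eigen_orthonormal_def by auto
    show "x = (\<Sum>b\<in>B. ip x b *\<^sub>R b)" if "x \<in> eigen c" for x
      by (rule eigen_expansion[OF fin B max that])
    show "ip (A x) (A x) \<le> c\<^sup>2 * ip x x" if "\<And>b. b \<in> B \<Longrightarrow> ip x b = 0" for x
      by (rule eigen_orthogonal_bound[OF fin B max assms that])
  qed
qed

end

section \<open>Convolution operators\<close>

context compact_metric_group
begin

lemma apply_Bcontfun [simp]:
  fixes f :: "'a \<Rightarrow> real"
  assumes "continuous_on UNIV f"
  shows "apply_bcontfun (Bcontfun f) = f"
  using assms compact_imp_bounded[OF compact_continuous_image[OF assms compact_UNIV]]
  by (simp add: Bcontfun_inverse bcontfun_def)

text \<open>Integrate the pointwise inequality |f| \<le> e/2 + f^2/(2e), which is (e - |f|)^2 \<ge>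
  0; the total mass is 1.\<close>

lemma haar_abs_le_L2:
  assumes f: "continuous_on UNIV f" and e: "0 < e" and le: "haar (\<lambda>x. f x * f x) \<le> e\<^sup>2"
  shows "haar (\<lambda>x. \<bar>f x\<bar>) \<le> e"
proof -
  have "haar (\<lambda>x. \<bar>f x\<bar>) \<le> haar (\<lambda>x. e / 2 + 1 / (2 * e) * (f x * f x))"
  proof (rule haar_mono)
    fix x
    have "0 \<le> (e - \<bar>f x\<bar>)\<^sup>2" by simp
    then have "\<bar>f x\<bar> * (2 * e) \<le> e\<^sup>2 + f x * f x" by (simp add: power2_diff) (simp add: power2_eq_square algebra_simps)
    then show "\<bar>f x\<bar> \<le> e / 2 + 1 / (2 * e) * (f x * f x)"
      using e by (simp add: field_simps power2_eq_square)
  qed (intro continuous_intros f)+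
  also have "\<dots> = e / 2 + 1 / (2 * e) * haar (\<lambda>x. f x * f x)"
    using haar_add[of "\<lambda>x. e / 2" "\<lambda>x. 1 / (2 * e) * (f x * f x)"]
      haar_cmult[of "\<lambda>x. f x * f x" "1 / (2 * e)"] f
    by (simp only: haar_const continuous_on_mult continuous_on_const simp_thms)
  also have "\<dots> \<le> e / 2 + 1 / (2 * e) * e\<^sup>2"
    using le e by (intro add_left_mono mult_left_mono) auto
  also have "\<dots> = e" using e by (simp add: power2_eq_square)
  finally show ?thesis .
qed

lemma haar_weighted_close:
  assumes w: "continuous_on UNIV w" "\<And>h. 0 \<le> w h" "haar w = 1"
    and g: "continuous_on UNIV g" "\<And>h. w h \<noteq> 0 \<Longrightarrow> \<bar>g h - y\<bar> \<le> r"
  shows "\<bar>haar (\<lambda>h. w h * g h) - y\<bar> \<le> r"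
proof -
  have "y = haar (\<lambda>h. y * w h)" using w by (simp add: haar_cmult)
  then have "\<bar>haar (\<lambda>h. w h * g h) - y\<bar> = \<bar>haar (\<lambda>h. w h * g h) - haar (\<lambda>h. y * w h)\<bar>" by simp
  also have "\<dots> = \<bar>haar (\<lambda>h. w h * g h - y * w h)\<bar>"
    by (subst haar_diff) (intro continuous_intros w g refl)+
  also have "\<dots> \<le> haar (\<lambda>h. \<bar>w h * g h - y * w h\<bar>)"
    by (intro haar_abs_le continuous_intros w g)
  also have "\<dots> \<le> haar (\<lambda>h. r * w h)"
  proof (rule haar_mono)
    fix h
    have "\<bar>w h * g h - y * w h\<bar> = w h * \<bar>g h - y\<bar>"
      using abs_mult[of "w h" "g h - y"] w(2)[of h] by (simp add: algebra_simps)
    also have "\<dots> \<le> r * w h"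
      using w(2)[of h] g(2)[of h] by (cases "w h = 0") (auto simp: mult.commute mult_left_mono)
    finally show "\<bar>w h * g h - y * w h\<bar> \<le> r * w h" .
  qed (intro continuous_intros w g)+
  also have "\<dots> = r" using w by (simp add: haar_cmult)
  finally show ?thesis .
qed

lemma ex_bump:
  assumes "0 < d"
  shows "\<exists>w. continuous_on UNIV w \<and> (\<forall>h. 0 \<le> w h) \<and> (\<forall>h. w (ginv h) = w h) \<and> haar w = 1 \<and>
    (\<forall>h. w h \<noteq> 0 \<longrightarrow> dist h 0 < d)"
proof -
  define v where "v h = max 0 (d - dist h 0)" for h :: 'a
  have v: "continuous_on UNIV v" unfolding v_def[abs_def] by (intro continuous_intros)
  have pos: "0 < haar v"
    using assms by (intro haar_pos[OF v, of 0]) (auto simp: v_def)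
  \<comment> \<open>Left invariance makes a tent function of the distance to \<open>0\<close>
    invariant under inversion, which later makes convolution with it symmetric.\<close>
  have "dist (ginv h) 0 = dist h 0" for h
    using dist_mul_left[of h "ginv h" 0] by (simp add: dist_commute)
  then have "v (ginv h) = v h" for h by (simp add: v_def)
  moreover have "haar (\<lambda>h. (1 / haar v) * v h) = 1" using pos by (simp only: haar_cmult[OF v]) simp
  moreover have "0 \<le> v h" "v h \<noteq> 0 \<Longrightarrow> dist h 0 < d" for h by (auto simp: v_def split: if_splits)
  ultimately show ?thesis using pos
    by (intro exI[of _ "\<lambda>h. (1 / haar v) * v h"]) (auto intro!: continuous_intros v)
qed

definition ip :: "('a \<Rightarrow>\<^sub>C real) \<Rightarrow> ('a \<Rightarrow>\<^sub>C real) \<Rightarrow> real"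
  where "ip f g = haar (\<lambda>x. apply_bcontfun f x * apply_bcontfun g x)"

text \<open>Substituting \<open>h \<odot> x\<close> for \<open>h\<close> turns this into an average
  of left translates of \<open>f\<close> (\<open>apply_conv_translate\<close>), which explains why
  it commutes with right translations. The kernel form keeps x out of the argument of
  \<open>f\<close>, as the compactness estimates require.\<close>

definition conv :: "('a \<Rightarrow> real) \<Rightarrow> ('a \<Rightarrow>\<^sub>C real) \<Rightarrow> ('a \<Rightarrow>\<^sub>C real)"
  where "conv w f = Bcontfun (\<lambda>x. haar (\<lambda>h. w (h \<odot> ginv x) * apply_bcontfun f h))"

definition translate :: "'a \<Rightarrow> ('a \<Rightarrow>\<^sub>C real) \<Rightarrow> ('a \<Rightarrow>\<^sub>C real)"
  where "translate g f = Bcontfun (\<lambda>h. apply_bcontfun f (h \<odot> g))"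

lemma continuous_on_comp:
  assumes "continuous_on UNIV w" "continuous_on S f"
  shows "continuous_on S (\<lambda>x. w (f x))"
  using continuous_on_compose2[OF assms] by simp

lemma continuous_on_kernel:
  assumes "continuous_on UNIV w"
  shows "continuous_on UNIV (\<lambda>(x, h). w (h \<odot> ginv x))"
  unfolding case_prod_beta by (intro continuous_on_comp[OF assms] continuous_intros)

lemma continuous_on_bcontfun_comp [continuous_intros]:
  "continuous_on S f \<Longrightarrow> continuous_on S (\<lambda>x. apply_bcontfun (F :: 'a \<Rightarrow>\<^sub>C real) (f x))"
  by (rule continuous_on_comp) auto

lemma apply_translate [simp]: "apply_bcontfun (translate g f) h = apply_bcontfun f (h \<odot> g)"
  unfolding translate_def by (subst apply_Bcontfun) (intro continuous_intros, rule refl)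

lemma apply_conv:
  assumes "continuous_on UNIV w"
  shows "apply_bcontfun (conv w f) x = haar (\<lambda>h. w (h \<odot> ginv x) * apply_bcontfun f h)"
  unfolding conv_def
proof (subst apply_Bcontfun)
  show "continuous_on UNIV (\<lambda>x. haar (\<lambda>h. w (h \<odot> ginv x) * apply_bcontfun f h))"
    unfolding case_prod_beta
    by (rule continuous_on_haar, unfold case_prod_beta) (intro continuous_intros continuous_on_comp[OF assms])
qed simp

lemma apply_conv_translate:
  assumes "continuous_on UNIV w"
  shows "apply_bcontfun (conv w f) x = haar (\<lambda>h. w h * apply_bcontfun f (h \<odot> x))"
  unfolding apply_conv[OF assms]
  by (subst haar_right[symmetric, of _ x]) (intro continuous_intros continuous_on_comp[OF assms], simp)

lemma conv_translate:
  assumes w: "continuous_on UNIV w"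
  shows "conv w (translate g f) = translate g (conv w f)"
  by (rule bcontfun_eqI) (simp add: apply_conv_translate[OF w] assoc)

text \<open>One estimate with two uses in \<open>conv_compact\<close>: w' = 0 gives equiboundedness,
  and a nearby translate of \<open>w\<close> gives equicontinuity. The L2 bound on \<open>f\<close>
  enters only through its L1 norm.\<close>

lemma conv_bound:
  assumes w: "continuous_on UNIV w" and f: "ip f f \<le> 1"
    and le: "\<And>h. \<bar>w (h \<odot> ginv x) - w' h\<bar> \<le> r" and w': "continuous_on UNIV w'"
  shows "\<bar>apply_bcontfun (conv w f) x - haar (\<lambda>h. w' h * apply_bcontfun f h)\<bar> \<le> r"
proof -
  have r: "0 \<le> r" using le[of x] by linarith
  have "apply_bcontfun (conv w f) x - haar (\<lambda>h. w' h * apply_bcontfun f h) =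
      haar (\<lambda>h. w (h \<odot> ginv x) * apply_bcontfun f h - w' h * apply_bcontfun f h)"
    unfolding apply_conv[OF w]
    by (subst haar_diff) (intro continuous_intros continuous_on_comp[OF w] w' refl)+
  also have "\<bar>\<dots>\<bar> \<le> haar (\<lambda>h. \<bar>w (h \<odot> ginv x) * apply_bcontfun f h - w' h * apply_bcontfun f h\<bar>)"
    by (intro haar_abs_le continuous_intros continuous_on_comp[OF w] w')
  also have "\<dots> \<le> haar (\<lambda>h. r * \<bar>apply_bcontfun f h\<bar>)"
  proof (rule haar_mono)
    fix h
    have "\<bar>w (h \<odot> ginv x) * apply_bcontfun f h - w' h * apply_bcontfun f h\<bar> =
        \<bar>w (h \<odot> ginv x) - w' h\<bar> * \<bar>apply_bcontfun f h\<bar>"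
      by (simp add: abs_mult[symmetric] left_diff_distrib)
    also have "\<dots> \<le> r * \<bar>apply_bcontfun f h\<bar>" by (intro mult_right_mono le) simp
    finally show "\<bar>w (h \<odot> ginv x) * apply_bcontfun f h - w' h * apply_bcontfun f h\<bar> \<le> r * \<bar>apply_bcontfun f h\<bar>" .
  qed (intro continuous_intros continuous_on_comp[OF w] w')+
  also have "\<dots> = r * haar (\<lambda>h. \<bar>apply_bcontfun f h\<bar>)"
    by (intro haar_cmult continuous_intros)
  also have "\<dots> \<le> r"
    using f by (intro mult_left_le r haar_abs_le_L2) (auto simp: ip_def intro: continuous_intros)
  finally show ?thesis .
qed

lemma conv_compact:
  assumes w: "continuous_on UNIV w"
  shows "\<exists>K. compact K \<and> (\<forall>f. ip f f \<le> 1 \<longrightarrow> conv w f \<in> K)"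
proof -
  have "bounded (range w)"
    by (rule compact_imp_bounded[OF compact_continuous_image[OF w compact_UNIV]])
  then obtain B where B: "\<And>h. \<bar>w h\<bar> \<le> B" unfolding bounded_iff by auto
  let ?F = "conv w ` {f. ip f f \<le> 1}"
  have "compact (closure ?F)"
  proof (rule compact_closure_equicontinuous[OF compact_UNIV, of _ B])
    fix f and x :: 'a assume "f \<in> ?F"
    then obtain f' where f': "ip f' f' \<le> 1" "f = conv w f'" by blast
    have "\<bar>apply_bcontfun (conv w f') x - haar (\<lambda>h. 0 * apply_bcontfun f' h)\<bar> \<le> B"
      using B by (intro conv_bound[OF w f'(1)]) auto
    then show "\<bar>apply_bcontfun f x\<bar> \<le> B" by (simp add: f')
  next
    fix r :: real assume "0 < r"
    from uniformly_continuous_left[OF continuous_on_kernel[OF w] this] obtain d where d: "0 < d"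
      "\<And>x y h. dist x y < d \<Longrightarrow> \<bar>w (h \<odot> ginv x) - w (h \<odot> ginv y)\<bar> < r" by blast
    show "\<exists>d>0. \<forall>f\<in>?F. \<forall>x y. dist x y < d \<longrightarrow> \<bar>apply_bcontfun f x - apply_bcontfun f y\<bar> \<le> r"
    proof (intro exI[of _ d] conjI ballI allI impI d(1))
      fix f and x y :: 'a assume "f \<in> ?F" and xy: "dist x y < d"
      then obtain f' where f': "ip f' f' \<le> 1" "f = conv w f'" by blast
      have "\<bar>apply_bcontfun (conv w f') x - haar (\<lambda>h. w (h \<odot> ginv y) * apply_bcontfun f' h)\<bar> \<le> r"
        using d(2)[OF xy] by (intro conv_bound[OF w f'(1)] less_imp_le continuous_on_comp[OF w] continuous_intros)
      then show "\<bar>apply_bcontfun f x - apply_bcontfun f y\<bar> \<le> r" by (simp add: f' apply_conv[OF w, of f' y])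
    qed
  qed
  moreover have "?F \<subseteq> closure ?F" by (rule closure_subset)
  ultimately show ?thesis by blast
qed

lemma conv_symmetric:
  assumes w: "continuous_on UNIV w" and sym: "\<And>h. w (ginv h) = w h"
  shows "ip (conv w f) g = ip f (conv w g)"
proof -
  have ws: "w (h \<odot> ginv x) = w (x \<odot> ginv h)" for h x
    using sym[of "h \<odot> ginv x"] by (simp add: inverse_distrib_swap)
  have "ip (conv w f) g = haar (\<lambda>x. haar (\<lambda>h. w (h \<odot> ginv x) * (apply_bcontfun f h * apply_bcontfun g x)))"
    unfolding ip_def apply_conv[OF w]
    by (subst (2) mult.commute, subst haar_cmult[symmetric])
      (auto intro!: continuous_intros continuous_on_comp[OF w] simp: algebra_simps)
  also have "\<dots> = haar (\<lambda>h. haar (\<lambda>x. w (h \<odot> ginv x) * (apply_bcontfun f h * apply_bcontfun g x)))"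
    by (rule haar_swap, unfold case_prod_beta) (intro continuous_intros continuous_on_comp[OF w])
  also have "\<dots> = ip f (conv w g)"
    unfolding ip_def apply_conv[OF w]
    by (subst haar_cmult[symmetric])
      (auto intro!: continuous_intros continuous_on_comp[OF w] simp: algebra_simps ws)
  finally show ?thesis .
qed

lemma symmetric_compact_operator_conv:
  assumes w: "continuous_on UNIV w" and sym: "\<And>h. w (ginv h) = w h"
  shows "symmetric_compact_operator ip (conv w)"
proof (rule symmetric_compact_operator.intro)
  fix f g k :: "'a \<Rightarrow>\<^sub>C real" and r :: real
  show "ip (f + g) k = ip f k + ip g k"
    unfolding ip_def by (subst haar_add[symmetric]) (auto intro!: continuous_intros simp: algebra_simps)
  show "ip (r *\<^sub>R f) g = r * ip f g"
    unfolding ip_def by (subst haar_cmult[symmetric]) (auto intro!: continuous_intros simp: algebra_simps)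
  show "ip f g = ip g f"
    unfolding ip_def by (simp add: mult.commute)
  show "0 < ip f f" if f: "f \<noteq> 0"
  proof -
    obtain a where "apply_bcontfun f a \<noteq> 0" using f bcontfun_eqI[of f 0] by (auto simp: zero_bcontfun.rep_eq)
    then show ?thesis
      unfolding ip_def by (intro haar_pos[where a = a] continuous_intros) (auto simp: zero_less_mult_iff)
  qed
  have "ip f f \<le> haar (\<lambda>x. (norm f)\<^sup>2)"
    unfolding ip_def
  proof (rule haar_mono)
    fix x
    have "\<bar>apply_bcontfun f x\<bar> \<le> norm f" using norm_bounded[of f x] by simp
    then have "\<bar>apply_bcontfun f x\<bar> ^ 2 \<le> norm f ^ 2" by (intro power_mono) auto
    then show "apply_bcontfun f x * apply_bcontfun f x \<le> (norm f)\<^sup>2"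
      by (simp add: power2_eq_square)
  qed (intro continuous_intros)+
  then show "ip f f \<le> (norm f)\<^sup>2" by simp
  show "linear (conv w)"
  proof
    show "conv w (f + g) = conv w f + conv w g" for f g
      by (rule bcontfun_eqI)
        (simp add: apply_conv[OF w] plus_bcontfun.rep_eq algebra_simps haar_add[symmetric] continuous_intros continuous_on_comp[OF w])
    show "conv w (r *\<^sub>R f) = r *\<^sub>R conv w f" for r f
      by (rule bcontfun_eqI)
        (simp add: apply_conv[OF w] scaleR_bcontfun.rep_eq algebra_simps haar_cmult[symmetric] continuous_intros continuous_on_comp[OF w])
  qed
qed (use conv_symmetric[OF w sym] conv_compact[OF w] in auto)

text \<open>The density part of the Peter--Weyl theorem, with finite-dimensional right-invariant
  spaces of functions in place of matrix coefficients.\<close>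
lemma translation_finite_approximation:
  assumes u: "continuous_on UNIV u" and r: "0 < r"
  shows "\<exists>k (B :: ('a \<Rightarrow>\<^sub>C real) set) c. continuous_on UNIV k \<and> finite B \<and> haar (\<lambda>h. \<bar>k h - u h\<bar>) \<le> r \<and>
    (\<forall>h x. k (h \<odot> ginv x) = (\<Sum>b\<in>B. c x b * apply_bcontfun b h))"
proof -
  define U where "U = Bcontfun u"
  have U: "apply_bcontfun U = u" by (simp add: U_def u)
  have r2: "0 < r / 2" using r by simp
  have "continuous_on UNIV (\<lambda>(h, x). u (h \<odot> x))"
    unfolding case_prod_beta by (intro continuous_on_comp[OF u] continuous_intros)
  from uniformly_continuous_left[OF this r2] obtain d where d: "0 < d"
    "\<And>h h' x. dist h h' < d \<Longrightarrow> \<bar>u (h \<odot> x) - u (h' \<odot> x)\<bar> < r / 2" by blast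
  from ex_bump[OF d(1)] obtain w where w: "continuous_on UNIV w" "\<And>h. 0 \<le> w h"
    "\<And>h. w (ginv h) = w h" "haar w = 1" "\<And>h. w h \<noteq> 0 \<Longrightarrow> dist h 0 < d" by blast
  interpret S: symmetric_compact_operator ip "conv w"
    by (rule symmetric_compact_operator_conv[OF w(1,3)])
  \<comment> \<open>Chosen so that c times the L2 norm of \<open>U\<close> is at most r/2; the
    summand 1 covers U = 0.\<close>
  define c where "c = r / (2 * (1 + sqrt (ip U U)))"
  have s: "0 \<le> sqrt (ip U U)" by (simp add: S.ip_nonneg)
  have c: "0 < c" using r s by (simp add: c_def add_pos_nonneg)
  have "c * sqrt (ip U U) \<le> r / 2"
    using r s by (simp add: c_def field_simps add_pos_nonneg)
  then have "(c * sqrt (ip U U))\<^sup>2 \<le> (r / 2)\<^sup>2" using c s by (intro power_mono) auto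
  then have cU: "c\<^sup>2 * ip U U \<le> (r / 2)\<^sup>2" by (simp add: power_mult_distrib S.ip_nonneg)
  obtain B where B: "finite B" "B \<subseteq> S.eigen c"
    "\<And>x y. x \<in> B \<Longrightarrow> y \<in> B \<Longrightarrow> ip x y = (if x = y then 1 else 0)"
    "\<And>x. x \<in> S.eigen c \<Longrightarrow> x = (\<Sum>b\<in>B. ip x b *\<^sub>R b)"
    "\<And>x. (\<And>b. b \<in> B \<Longrightarrow> ip x b = 0) \<Longrightarrow> ip (conv w x) (conv w x) \<le> c\<^sup>2 * ip x x"
  proof (rule S.spectral_truncation[OF c], goal_cases)
    case (1 B)
    show ?case by (rule 1(1)[of B, OF 1(2-)])
  qed
  have ortho: "S.eigen_orthonormal c B" using B(2,3) unfolding S.eigen_orthonormal_def by auto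
  \<comment> \<open>U - PU need not be small, but its convolution is: at most r/2 in L2 by the
    truncation bound. The other half of the error is the uniform distance between conv w U and
    \<open>u\<close>, controlled by the support of the bump.\<close>
  define PU where "PU = (\<Sum>b\<in>B. ip U b *\<^sub>R b)"
  define K where "K = conv w PU"
  have orth: "ip (U - PU) b = 0" if "b \<in> B" for b
    using S.ip_projection[OF B(1) ortho that] by (simp add: PU_def S.ip_diff_left)
  have "ip (U - PU) PU = (\<Sum>b\<in>B. ip U b * ip (U - PU) b)"
    unfolding S.ip_commute[of "U - PU"] by (subst (1) PU_def) (simp only: S.ip_sum_left S.ip_scaleR_left)
  then have "ip (U - PU) PU = 0" using orth by simp
  then have "ip U U = ip (U - PU) (U - PU) + ip PU PU"
    by (simp add: S.ip_diff_left S.ip_diff_right S.ip_commute[of PU U])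
  then have "ip (U - PU) (U - PU) \<le> ip U U" using S.ip_nonneg[of PU] by linarith
  then have "c\<^sup>2 * ip (U - PU) (U - PU) \<le> (r / 2)\<^sup>2"
    using cU by (meson mult_left_mono order_trans zero_le_power2)
  with B(5)[OF orth] have "ip (conv w (U - PU)) (conv w (U - PU)) \<le> (r / 2)\<^sup>2" by linarith
  then have L1: "haar (\<lambda>h. \<bar>apply_bcontfun (conv w (U - PU)) h\<bar>) \<le> r / 2"
    unfolding ip_def by (intro haar_abs_le_L2 r2) auto
  have sup: "\<bar>apply_bcontfun (conv w U) x - u x\<bar> \<le> r / 2" for x
    unfolding apply_conv_translate[OF w(1)] U
  proof (rule haar_weighted_close[OF w(1,2,4)])
    show "continuous_on UNIV (\<lambda>h. u (h \<odot> x))" by (intro continuous_on_comp[OF u] continuous_intros)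
    show "\<bar>u (h \<odot> x) - u x\<bar> \<le> r / 2" if "w h \<noteq> 0" for h
      using d(2)[OF w(5)[OF that], of x] by (simp add: group_left_neutral)
  qed
  have "haar (\<lambda>h. \<bar>apply_bcontfun K h - u h\<bar>) \<le> haar (\<lambda>h. r / 2 + \<bar>apply_bcontfun (conv w (U - PU)) h\<bar>)"
  proof (rule haar_mono)
    fix h
    have "conv w (U - PU) = conv w U - K" unfolding K_def by (rule linear_diff[OF S.linear_A])
    then have "apply_bcontfun (conv w (U - PU)) h = apply_bcontfun (conv w U) h - apply_bcontfun K h"
      by (simp add: minus_bcontfun.rep_eq)
    with sup[of h] show "\<bar>apply_bcontfun K h - u h\<bar> \<le> r / 2 + \<bar>apply_bcontfun (conv w (U - PU)) h\<bar>"
      by linarith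
  qed (intro continuous_intros u)+
  also have "\<dots> \<le> r" using L1 by (subst haar_add) (auto intro!: continuous_intros)
  finally have close: "haar (\<lambda>h. \<bar>apply_bcontfun K h - u h\<bar>) \<le> r" .
  have "\<forall>b\<in>B. \<exists>l. conv w b = l *\<^sub>R b" using B(2) unfolding S.eigen_def by blast
  then obtain l where l: "\<And>b. b \<in> B \<Longrightarrow> conv w b = l b *\<^sub>R b" by metis
  have K: "K = (\<Sum>b\<in>B. (ip U b * l b) *\<^sub>R b)"
    unfolding K_def PU_def by (simp add: linear_sum[OF S.linear_A] linear_scale[OF S.linear_A] l)
  have apply_sum: "apply_bcontfun (\<Sum>b\<in>B. f b *\<^sub>R b) h = (\<Sum>b\<in>B. f b * apply_bcontfun b h)" for f h
    by (induction B rule: infinite_finite_induct) (auto simp: plus_bcontfun.rep_eq scaleR_bcontfun.rep_eq zero_bcontfun.rep_eq)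
  have "apply_bcontfun K (h \<odot> ginv x) =
      (\<Sum>b'\<in>B. (\<Sum>b\<in>B. ip U b * l b * ip (translate (ginv x) b) b') * apply_bcontfun b' h)" for h x
  proof -
    have tr: "apply_bcontfun b (h \<odot> ginv x) = (\<Sum>b'\<in>B. ip (translate (ginv x) b) b' * apply_bcontfun b' h)"
      if b: "b \<in> B" for b
    proof -
      \<comment> \<open>The translate keeps the eigenvalue of \<open>b\<close>, so the expansion
        property of \<open>B\<close> applies to it. Only the coefficients depend on
        \<open>x\<close>.\<close>
      have "translate (ginv x) b \<in> S.eigen c"
      proof -
        obtain m where m: "c \<le> \<bar>m\<bar>" "conv w b = m *\<^sub>R b" using b B(2) unfolding S.eigen_def by blast
        have "conv w (translate (ginv x) b) = m *\<^sub>R translate (ginv x) b"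
          unfolding conv_translate[OF w(1)] m(2) by (rule bcontfun_eqI) (simp add: scaleR_bcontfun.rep_eq)
        with m(1) show ?thesis unfolding S.eigen_def by blast
      qed
      from arg_cong[OF B(4)[OF this], of "\<lambda>f. apply_bcontfun f h"] show ?thesis
        unfolding apply_sum apply_translate .
    qed
    show ?thesis
      unfolding K apply_sum
      by (simp add: tr sum_distrib_left sum_distrib_right mult.assoc) (rule sum.swap)
  qed
  with B(1) close show ?thesis
    by (intro exI[of _ "apply_bcontfun K"] exI[of _ B]
        exI[of _ "\<lambda>x b'. \<Sum>b\<in>B. ip U b * l b * ip (translate (ginv x) b) b'"]) auto
qed

end

section \<open>Lipschitz-free spaces\<close>

text \<open>If \<open>a\<close> has distance at least \<delta> > 0 from the closed span, the
  coefficient of \<open>a\<close> depends on the vector with Lipschitz constant 1/\<delta>. Along a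
  convergent sequence the coefficients therefore converge, and so do the remainders.\<close>

lemma closed_span_insert:
  fixes S :: "'b::real_normed_vector set"
  assumes closed: "closed (span S)"
  shows "closed (span (insert a S))"
proof (cases "a \<in> span S")
  case True
  then show ?thesis using closed by (simp add: span_redundant)
next
  case False
  then obtain \<delta> where "0 < \<delta>" "ball a \<delta> \<subseteq> - span S"
    using openE[of "- span S" a] closed unfolding closed_def by (metis ComplI)
  then have \<delta>: "0 < \<delta>" "\<And>s. s \<in> span S \<Longrightarrow> \<delta> \<le> dist a s"
    by (auto simp: subset_iff not_less)
  have lower: "\<delta> * \<bar>t\<bar> \<le> norm (t *\<^sub>R a + s)" if s: "s \<in> span S" for t s
  proof (cases "t = 0")
    case False
    have "(- 1 / t) *\<^sub>R s \<in> span S" using s by (rule span_scale)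
    from \<delta>(2)[OF this] have "\<bar>t\<bar> * \<delta> \<le> \<bar>t\<bar> * norm (a + (1 / t) *\<^sub>R s)"
      by (intro mult_left_mono) (auto simp: dist_norm)
    also have "\<dots> = norm (t *\<^sub>R (a + (1 / t) *\<^sub>R s))" by simp
    also have "t *\<^sub>R (a + (1 / t) *\<^sub>R s) = t *\<^sub>R a + s" using False by (simp add: scaleR_right_distrib)
    finally show ?thesis by (simp add: mult.commute)
  qed simp
  show ?thesis
    unfolding closed_sequential_limits
  proof (intro allI impI, elim conjE)
    fix x l assume x: "\<forall>n. x n \<in> span (insert a S)" and lim: "x \<longlonglongrightarrow> l"
    then have "\<forall>n. \<exists>t. x n - t *\<^sub>R a \<in> span S" by (simp add: span_breakdown_eq)
    then obtain t where t: "\<And>n. x n - t n *\<^sub>R a \<in> span S" by metis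
    have "Cauchy t"
      unfolding Cauchy_def
    proof (intro allI impI)
      fix e :: real assume e: "0 < e"
      from metric_CauchyD[OF LIMSEQ_imp_Cauchy[OF lim], of "\<delta> * e"] e \<delta>(1) obtain M where
        M: "\<And>m n. m \<ge> M \<Longrightarrow> n \<ge> M \<Longrightarrow> dist (x m) (x n) < \<delta> * e" by auto
      have "dist (t m) (t n) < e" if "m \<ge> M" "n \<ge> M" for m n
      proof -
        have "(x m - t m *\<^sub>R a) - (x n - t n *\<^sub>R a) \<in> span S" by (intro span_diff t)
        from lower[OF this, of "t m - t n"] have "\<delta> * \<bar>t m - t n\<bar> \<le> dist (x m) (x n)"
          by (simp add: dist_norm algebra_simps)
        also have "\<dots> < \<delta> * e" by (rule M[OF that])
        finally show ?thesis using \<delta>(1) by (simp add: dist_real_def)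
      qed
      then show "\<exists>M. \<forall>m\<ge>M. \<forall>n\<ge>M. dist (t m) (t n) < e" by blast
    qed
    then obtain t0 where "t \<longlonglongrightarrow> t0" using Cauchy_convergent convergent_def by blast
    then have "(\<lambda>n. x n - t n *\<^sub>R a) \<longlonglongrightarrow> l - t0 *\<^sub>R a"
      by (intro tendsto_intros lim)
    with closed t have "l - t0 *\<^sub>R a \<in> span S" by (rule closed_sequentially)
    then show "l \<in> span (insert a S)" by (auto simp: span_breakdown_eq)
  qed
qed

lemma closed_span_finite:
  fixes B :: "'b::real_normed_vector set"
  assumes "finite B"
  shows "closed (span B)"
  using assms by (induction B) (simp_all add: closed_span_insert)

section \<open>Reduction of the approximation property to operators on Lip_0\<close>

lemma linear_functional_of_free: "linear functional_of_free"
  by (rule linearI) (simp_all add: plus_lipschitz_free.rep_eq scaleR_lipschitz_free.rep_eq)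

lemma norm_functional_of_free: "norm (functional_of_free u) = norm u"
  by (simp add: norm_lipschitz_free.rep_eq)

lemma norm_lip_delta_le: "norm (lip_delta x) \<le> dist x 0"
proof (rule norm_blinfun_bound)
  fix f :: "'a lip0"
  show "norm (blinfun_apply (lip_delta x) f) \<le> dist x 0 * norm f"
    using lip0_dist_le[of f x 0] by (simp add: lip_delta.rep_eq mult.commute)
qed simp

lemma norm_lip0_le:
  assumes "0 \<le> C" "\<And>x y. \<bar>lip0_apply f x - lip0_apply f y\<bar> \<le> C * dist x y"
  shows "norm f \<le> C"
  unfolding norm_lip0.rep_eq using assms by (intro lip_const_le lipschitz_onI) (auto simp: dist_real_def)

lemma continuous_on_lip0_apply: "continuous_on UNIV (lip0_apply f)"
  using lip0_apply[of f] by (auto intro: lipschitz_on_continuous_on)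

text \<open>\<open>T\<close> is the restriction to the free space of the adjoint of
  \<open>P\<close>. The adjoint sends point masses into span B, which is finite-dimensional and
  hence closed, so it sends the whole closed span there, and span B lies in the free space.\<close>

lemma ex_pullback_to_span:
  fixes P :: "'a::{metric_space, zero} lip0 \<Rightarrow>\<^sub>L 'a lip0"
  assumes B: "finite B" "B \<subseteq> closure (span (range lip_delta))"
    and P: "norm P \<le> 1" "\<And>x. lip_delta x o\<^sub>L P \<in> span B"
  shows "\<exists>T :: 'a lipschitz_free \<Rightarrow>\<^sub>L 'a lipschitz_free. finite_rank T \<and> norm T \<le> 1 \<and>
    (\<forall>u. functional_of_free (blinfun_apply T u) = functional_of_free u o\<^sub>L P)"
proof -
  let ?F = "closure (span (range (lip_delta :: 'a \<Rightarrow> _)))"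
  have lin: "linear (\<lambda>m :: 'a lip0 \<Rightarrow>\<^sub>L real. m o\<^sub>L P)"
    by (intro bounded_linear.linear bounded_bilinear.bounded_linear_left[OF bounded_bilinear_blinfun_compose])
  have "(\<lambda>m. m o\<^sub>L P) ` span (range lip_delta) \<subseteq> span B"
    unfolding linear_span_image[OF lin, symmetric] using P(2) by (intro span_minimal) auto
  then have "(\<lambda>m. m o\<^sub>L P) ` ?F \<subseteq> span B"
    by (intro image_closure_subset closed_span_finite B continuous_intros)
  then have span: "functional_of_free u o\<^sub>L P \<in> span B" for u :: "'a lipschitz_free"
    using functional_of_free[of u] by blast
  have "span B \<subseteq> ?F"
    using B(2) by (intro span_minimal subspace_closed_span_lip_delta)
  then have inv_span: "functional_of_free (Lipschitz_free m) = m" if "m \<in> span B" for m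
    using that by (intro Lipschitz_free_inverse) blast
  note inv = inv_span[OF span]
  define T where "T = Blinfun (\<lambda>u :: 'a lipschitz_free. Lipschitz_free (functional_of_free u o\<^sub>L P))"
  have "norm (Lipschitz_free (functional_of_free u o\<^sub>L P)) \<le> norm u * 1" for u :: "'a lipschitz_free"
  proof -
    have "norm (functional_of_free u o\<^sub>L P) \<le> norm (functional_of_free u) * norm P" by (rule norm_blinfun_compose)
    also have "\<dots> \<le> norm u * 1" using P(1) by (intro mult_mono) (auto simp: norm_functional_of_free)
    finally show ?thesis by (simp add: inv flip: norm_functional_of_free)
  qed
  note bound = this
  have "bounded_linear (\<lambda>u :: 'a lipschitz_free. Lipschitz_free (functional_of_free u o\<^sub>L P))"
    by (rule bounded_linear_intro[OF _ _ bound]; rule functional_of_free_inject[THEN iffD1])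
      (simp_all add: inv inv_span span span_add span_scale plus_lipschitz_free.rep_eq
        scaleR_lipschitz_free.rep_eq linear_add[OF lin] linear_scale[OF lin])
  then have T: "blinfun_apply T u = Lipschitz_free (functional_of_free u o\<^sub>L P)" for u
    unfolding T_def by (simp add: bounded_linear_Blinfun_apply)
  have "range (blinfun_apply T) \<subseteq> span (Lipschitz_free ` B)"
  proof
    fix v assume "v \<in> range (blinfun_apply T)"
    then have "functional_of_free v \<in> span B" using span inv by (auto simp: T)
    also have "B = functional_of_free ` Lipschitz_free ` B"
      using B(2) by (force simp: image_image Lipschitz_free_inverse)
    finally have "functional_of_free v \<in> functional_of_free ` span (Lipschitz_free ` B)"
      by (simp only: linear_span_image[OF linear_functional_of_free])
    then show "v \<in> span (Lipschitz_free ` B)" by (auto simp: functional_of_free_inject)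
  qed
  then have "finite_rank T" unfolding finite_rank_def using B(1) by blast
  moreover have "norm T \<le> 1"
    using bound by (intro norm_blinfun_bound) (simp_all add: T mult.commute)
  ultimately show ?thesis by (intro exI[of _ T]) (simp add: T inv)
qed

text \<open>Closeness to the identity on point masses passes to a finite combination with a constant
  depending on that combination. A compact set is covered by small balls around finitely many
  combinations, and the norm bound handles the rest of each ball.\<close>

lemma metric_approximation_propertyI:
  assumes approx: "\<And>r. 0 < r \<Longrightarrow> \<exists>(P :: 'a::{metric_space, zero} lip0 \<Rightarrow>\<^sub>L 'a lip0) B.
    finite B \<and> B \<subseteq> closure (span (range lip_delta)) \<and> norm P \<le> 1 \<and>
    (\<forall>x. lip_delta x o\<^sub>L P \<in> span B) \<and> (\<forall>x. norm ((lip_delta x o\<^sub>L P) - lip_delta x) \<le> r)"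
  shows "metric_approximation_property TYPE('a lipschitz_free)"
  unfolding metric_approximation_property_def
proof (intro allI impI)
  fix K :: "'a lipschitz_free set" and \<epsilon> :: real assume K: "compact K" and \<epsilon>: "0 < \<epsilon>"
  let ?D = "span (range (lip_delta :: 'a \<Rightarrow> _))"
  \<comment> \<open>The order of quantifiers matters: \<open>r\<close> is computed from these
    constants, and only afterwards is \<open>P\<close> chosen for \<open>r\<close>.\<close>
  have sensitive: "\<exists>C\<ge>0. \<forall>P r. 0 \<le> r \<longrightarrow> (\<forall>x. norm ((lip_delta x o\<^sub>L P) - lip_delta x) \<le> r) \<longrightarrow> norm ((s o\<^sub>L P) - s) \<le> C * r"
    if "s \<in> ?D" for s :: "'a lip0 \<Rightarrow>\<^sub>L real"
    using that
  proof (induction rule: span_induct_alt)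
    case base
    show ?case by (intro exI[of _ 0]) (auto simp: blinfun_compose_zero)
  next
    case (step c z s)
    then obtain C x where C: "0 \<le> C" "\<And>P r. 0 \<le> r \<Longrightarrow> (\<And>x. norm ((lip_delta x o\<^sub>L P) - lip_delta x) \<le> r) \<Longrightarrow> norm ((s o\<^sub>L P) - s) \<le> C * r"
      and z: "z = lip_delta x" by auto
    show ?case
    proof (intro exI[of _ "\<bar>c\<bar> + C"] conjI allI impI)
      fix P :: "'a lip0 \<Rightarrow>\<^sub>L 'a lip0" and r :: real
      assume r: "0 \<le> r" and P: "\<forall>x. norm ((lip_delta x o\<^sub>L P) - lip_delta x) \<le> r"
      have "((c *\<^sub>R z + s) o\<^sub>L P) - (c *\<^sub>R z + s) = c *\<^sub>R ((z o\<^sub>L P) - z) + ((s o\<^sub>L P) - s)"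
        by (rule blinfun_eqI) (simp add: blinfun.bilinear_simps algebra_simps)
      also have "norm \<dots> \<le> \<bar>c\<bar> * norm ((z o\<^sub>L P) - z) + norm ((s o\<^sub>L P) - s)"
        by (rule order_trans[OF norm_triangle_ineq]) simp
      also have "\<dots> \<le> \<bar>c\<bar> * r + C * r"
        using P C(2)[OF r] by (intro add_mono mult_left_mono) (auto simp: z)
      finally show "norm (((c *\<^sub>R z + s) o\<^sub>L P) - (c *\<^sub>R z + s)) \<le> (\<bar>c\<bar> + C) * r" by (simp add: algebra_simps)
    qed (use C(1) in auto)
  qed
  have "\<exists>s. functional_of_free s \<in> ?D \<and> dist u s < \<epsilon> / 4" for u :: "'a lipschitz_free"
  proof -
    have "\<exists>m\<in>?D. dist m (functional_of_free u) < \<epsilon> / 4"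
      using functional_of_free[of u, unfolded closure_approachable, rule_format, of "\<epsilon> / 4"] \<epsilon> by simp
    then obtain m where m: "m \<in> ?D" "dist m (functional_of_free u) < \<epsilon> / 4" by blast
    have "functional_of_free (Lipschitz_free m) = m"
      using m(1) closure_subset by (intro Lipschitz_free_inverse) blast
    with m show ?thesis
      by (intro exI[of _ "Lipschitz_free m"])
        (simp add: dist_norm norm_lipschitz_free.rep_eq minus_lipschitz_free.rep_eq norm_minus_commute)
  qed
  then obtain s where s: "\<And>u :: 'a lipschitz_free. functional_of_free (s u) \<in> ?D" "\<And>u. dist u (s u) < \<epsilon> / 4"
    by metis
  have cover: "K \<subseteq> (\<Union>u\<in>K. ball (s u) (\<epsilon> / 4))" using s(2) by (force simp: dist_commute)
  obtain U where U: "U \<subseteq> K" "finite U" "K \<subseteq> (\<Union>u\<in>U. ball (s u) (\<epsilon> / 4))"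
    by (rule compactE_image[OF K _ cover]) auto
  obtain C where C: "\<And>u. 0 \<le> C u" "\<And>u P r. 0 \<le> r \<Longrightarrow> (\<And>x. norm ((lip_delta x o\<^sub>L P) - lip_delta x) \<le> r) \<Longrightarrow>
      norm ((functional_of_free (s u) o\<^sub>L P) - functional_of_free (s u)) \<le> C u * r"
    using sensitive[OF s(1)] by metis
  \<comment> \<open>Dominates each of the finitely many constants and stays positive, so that with r
    = \<epsilon>/(4S) every centre moves by at most \<epsilon>/4.\<close>
  define S where "S = 1 + sum C U"
  define r where "r = \<epsilon> / (4 * S)"
  have C_pos: "0 < S" using C(1) by (simp add: S_def add_pos_nonneg sum_nonneg)
  then have r: "0 < r" using \<epsilon> by (simp add: r_def)
  from approx[OF r] obtain P :: "'a lip0 \<Rightarrow>\<^sub>L 'a lip0" and B where P: "finite B"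
    "B \<subseteq> closure (span (range lip_delta))" "norm P \<le> 1" "\<And>x. lip_delta x o\<^sub>L P \<in> span B"
    "\<And>x. norm ((lip_delta x o\<^sub>L P) - lip_delta x) \<le> r" by blast
  from ex_pullback_to_span[OF P(1-4)] obtain T :: "'a lipschitz_free \<Rightarrow>\<^sub>L 'a lipschitz_free" where T:
    "finite_rank T" "norm T \<le> 1" "\<And>u. functional_of_free (blinfun_apply T u) = functional_of_free u o\<^sub>L P" by blast
  have "norm (blinfun_apply T u - u) < \<epsilon>" if "u \<in> K" for u
  proof -
    from U(3) that obtain v where v: "v \<in> U" "dist (s v) u < \<epsilon> / 4" by auto
    have "C v * r \<le> S * r"
      using member_le_sum[of v U C] v(1) U(2) C(1) r by (intro mult_right_mono) (auto simp: S_def)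
    also have "\<dots> = \<epsilon> / 4" using C_pos by (simp add: r_def)
    finally have "norm ((functional_of_free (s v) o\<^sub>L P) - functional_of_free (s v)) \<le> \<epsilon> / 4"
      using C(2)[of r P v] P(5) r by (meson less_imp_le order_trans)
    then have 1: "norm (blinfun_apply T (s v) - s v) \<le> \<epsilon> / 4"
      by (simp add: norm_lipschitz_free.rep_eq minus_lipschitz_free.rep_eq T(3))
    have "norm (blinfun_apply T (u - s v)) \<le> norm T * norm (u - s v)" by (rule norm_blinfun)
    also have "\<dots> \<le> 1 * norm (u - s v)" by (intro mult_right_mono T) simp
    finally have 2: "norm (blinfun_apply T (u - s v)) \<le> \<epsilon> / 4"
      using v(2) by (simp add: dist_norm norm_minus_commute)
    have "blinfun_apply T u - u = blinfun_apply T (u - s v) + (blinfun_apply T (s v) - s v) + (s v - u)"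
      by (simp add: blinfun.diff_right)
    also have "norm \<dots> \<le> norm (blinfun_apply T (u - s v)) + norm (blinfun_apply T (s v) - s v) + norm (s v - u)"
      by (intro order_trans[OF norm_triangle_ineq] add_right_mono norm_triangle_ineq)
    also have "\<dots> \<le> \<epsilon> / 4 + \<epsilon> / 4 + \<epsilon> / 4"
      using 1 2 v(2) by (intro add_mono) (auto simp: dist_norm)
    also have "\<dots> < \<epsilon>" using \<epsilon> by simp
    finally show ?thesis .
  qed
  with T(1,2) show "\<exists>T :: 'a lipschitz_free \<Rightarrow>\<^sub>L 'a lipschitz_free. finite_rank T \<and> norm T \<le> 1 \<and>
      (\<forall>x\<in>K. norm (blinfun_apply T x - x) < \<epsilon>)" by blast
qed

section \<open>Averaging operators on Lip_0\<close>

context compact_metric_group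
begin

lemma haar_mult_le:
  assumes "continuous_on UNIV k" "continuous_on UNIV g" "\<And>h. \<bar>g h\<bar> \<le> C"
  shows "\<bar>haar (\<lambda>h. k h * g h)\<bar> \<le> haar (\<lambda>h. \<bar>k h\<bar>) * C"
proof -
  have "\<bar>haar (\<lambda>h. k h * g h)\<bar> \<le> haar (\<lambda>h. \<bar>k h * g h\<bar>)"
    by (intro haar_abs_le continuous_intros assms)
  also have "\<dots> \<le> haar (\<lambda>h. C * \<bar>k h\<bar>)"
    by (intro haar_mono continuous_intros assms) (simp add: abs_mult mult.commute[of C] mult_left_mono assms(3))
  also have "\<dots> = haar (\<lambda>h. \<bar>k h\<bar>) * C"
    by (subst haar_cmult) (auto intro!: continuous_intros assms)
  finally show ?thesis .
qed

lemma ex_diameter_bound: "\<exists>D\<ge>0. \<forall>x :: 'a. dist x 0 \<le> D"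
proof -
  obtain D where D: "\<forall>x :: 'a. dist 0 x \<le> D"
    using compact_imp_bounded[OF compact_UNIV] bounded_any_center[of UNIV "0 :: 'a"] by auto
  then have "0 \<le> D" using zero_le_dist order_trans by blast
  with D show ?thesis by (auto simp: dist_commute)
qed

definition density_functional :: "('a \<Rightarrow> real) \<Rightarrow> 'a lip0 \<Rightarrow>\<^sub>L real"
  where "density_functional a = Blinfun (\<lambda>f. haar (\<lambda>h. a h * lip0_apply f h))"

lemma continuous_on_lip0_comp [continuous_intros]:
  "continuous_on S g \<Longrightarrow> continuous_on S (\<lambda>x. lip0_apply (f :: 'a lip0) (g x))"
  by (rule continuous_on_comp[OF continuous_on_lip0_apply])

lemma apply_density_functional:
  assumes a: "continuous_on UNIV a"
  shows "blinfun_apply (density_functional a) f = haar (\<lambda>h. a h * lip0_apply f h)"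
proof -
  obtain D where D: "0 \<le> D" "\<And>x :: 'a. dist x 0 \<le> D" using ex_diameter_bound by blast
  have "bounded_linear (\<lambda>f :: 'a lip0. haar (\<lambda>h. a h * lip0_apply f h))"
  proof (rule bounded_linear_intro)
    fix f g :: "'a lip0" and r :: real
    show "haar (\<lambda>h. a h * lip0_apply (f + g) h) = haar (\<lambda>h. a h * lip0_apply f h) + haar (\<lambda>h. a h * lip0_apply g h)"
      by (subst haar_add[symmetric]) (auto intro!: continuous_intros a simp: plus_lip0.rep_eq algebra_simps)
    show "haar (\<lambda>h. a h * lip0_apply (r *\<^sub>R f) h) = r *\<^sub>R haar (\<lambda>h. a h * lip0_apply f h)"
      unfolding real_scaleR_def
      by (subst haar_cmult[symmetric]) (auto intro!: continuous_intros a simp: scaleR_lip0.rep_eq algebra_simps)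
    have "\<bar>lip0_apply f h\<bar> \<le> norm f * D" for h
    proof -
      have "\<bar>lip0_apply f h\<bar> \<le> norm f * dist h 0" using lip0_dist_le[of f h 0] by simp
      also have "\<dots> \<le> norm f * D" by (intro mult_left_mono D) simp
      finally show ?thesis .
    qed
    then have "\<bar>haar (\<lambda>h. a h * lip0_apply f h)\<bar> \<le> haar (\<lambda>h. \<bar>a h\<bar>) * (norm f * D)"
      by (intro haar_mult_le a continuous_intros)
    then show "norm (haar (\<lambda>h. a h * lip0_apply f h)) \<le> norm f * (haar (\<lambda>h. \<bar>a h\<bar>) * D)"
      by (simp add: ac_simps)
  qed
  then show ?thesis unfolding density_functional_def by (simp add: bounded_linear_Blinfun_apply)
qed

text \<open>Move the mass lying under each partition function \<open>p b\<close> to the point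
  \<open>b\<close>. No mass travels further than d, so the pairing with \<open>f\<close> changes by
  at most the L1 norm of the density times norm f * d.\<close>

lemma density_functional_in_closure:
  assumes a: "continuous_on UNIV a"
  shows "density_functional a \<in> closure (span (range lip_delta))"
  unfolding closure_approachable
proof (intro allI impI)
  fix e :: real assume e: "0 < e"
  define A where "A = 1 + haar (\<lambda>h. \<bar>a h\<bar>)"
  have A: "0 \<le> haar (\<lambda>h. \<bar>a h\<bar>)" by (intro haar_nonneg continuous_intros a) simp
  define d where "d = e / (2 * A)"
  have A0: "0 < A" using A by (simp add: A_def add_pos_nonneg)
  then have d: "0 < d" using e by (simp add: d_def)
  obtain N and p :: "'a \<Rightarrow> 'a \<Rightarrow> real" where N: "finite N" and cont: "\<And>a. continuous_on UNIV (p a)"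
    and p: "\<And>a x. 0 \<le> p a x" "\<And>x. (\<Sum>a\<in>N. p a x) = 1" "\<And>a x. p a x \<noteq> 0 \<Longrightarrow> dist a x < d"
  proof (rule partition_of_unity[OF compact_UNIV d], goal_cases)
    case (1 N p)
    show ?case by (rule 1(1)[of N p, OF 1(2-)])
  qed
  define m where "m = (\<Sum>b\<in>N. haar (\<lambda>h. a h * p b h) *\<^sub>R lip_delta b)"
  have m: "blinfun_apply m f = haar (\<lambda>h. a h * (\<Sum>b\<in>N. p b h * lip0_apply f b))" for f
  proof -
    have "blinfun_apply m f = (\<Sum>b\<in>N. lip0_apply f b * haar (\<lambda>h. a h * p b h))"
      by (simp add: m_def blinfun.sum_left blinfun.scaleR_left lip_delta.rep_eq mult.commute)
    also have "\<dots> = (\<Sum>b\<in>N. haar (\<lambda>h. lip0_apply f b * (a h * p b h)))"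
      by (intro sum.cong refl haar_cmult[symmetric] continuous_intros a cont)
    also have "\<dots> = haar (\<lambda>h. \<Sum>b\<in>N. lip0_apply f b * (a h * p b h))"
      by (intro haar_sum[symmetric] continuous_intros a cont)
    finally show ?thesis by (simp add: sum_distrib_left ac_simps)
  qed
  have "norm (density_functional a - m) \<le> A * d"
  proof (rule norm_blinfun_bound)
    show "0 \<le> A * d" using A d by (simp add: A_def)
    fix f :: "'a lip0"
    have approx: "\<bar>lip0_apply f h - (\<Sum>b\<in>N. p b h * lip0_apply f b)\<bar> \<le> norm f * d" for h
    proof (rule partition_of_unity_approx[OF N p(1,2)])
      fix b assume "p b h \<noteq> 0"
      then have "norm f * dist h b \<le> norm f * d"
        using p(3) by (intro mult_left_mono) (auto simp: dist_commute less_imp_le)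
      with lip0_dist_le[of f h b] show "\<bar>lip0_apply f h - lip0_apply f b\<bar> \<le> norm f * d" by linarith
    qed
    have "blinfun_apply (density_functional a - m) f =
        haar (\<lambda>h. a h * (lip0_apply f h - (\<Sum>b\<in>N. p b h * lip0_apply f b)))"
      unfolding blinfun.diff_left m apply_density_functional[OF a]
      by (subst haar_diff[symmetric]) (auto intro!: continuous_intros a cont simp: right_diff_distrib)
    also have "\<bar>\<dots>\<bar> \<le> haar (\<lambda>h. \<bar>a h\<bar>) * (norm f * d)"
      by (intro haar_mult_le a continuous_intros cont approx)
    also have "\<dots> \<le> A * (norm f * d)"
      using d by (intro mult_right_mono) (auto simp: A_def)
    finally show "norm (blinfun_apply (density_functional a - m) f) \<le> A * d * norm f"
      by (simp add: ac_simps)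
  qed
  also have "A * d = e / 2" using A0 by (simp add: d_def)
  finally have "dist m (density_functional a) < e"
    using e by (simp add: dist_norm norm_minus_commute)
  moreover have "m \<in> span (range lip_delta)"
    unfolding m_def by (intro span_sum span_scale span_base) simp
  ultimately show "\<exists>y\<in>span (range lip_delta). dist y (density_functional a) < e" by blast
qed

text \<open>Left translation moves the base point. Subtracting f h changes the average by a constant
  only, leaving Lipschitz estimates intact and making the value at \<open>0\<close> vanish.\<close>

definition average :: "('a \<Rightarrow> real) \<Rightarrow> 'a lip0 \<Rightarrow>\<^sub>L 'a lip0"
  where "average k = Blinfun (\<lambda>f. Lip0 (\<lambda>x. haar (\<lambda>h. k h * (lip0_apply f (h \<odot> x) - lip0_apply f h))))"

lemma average:
  assumes k: "continuous_on UNIV k"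
  shows lip0_apply_average: "lip0_apply (blinfun_apply (average k) f) x =
      haar (\<lambda>h. k h * (lip0_apply f (h \<odot> x) - lip0_apply f h))"
    and norm_average_le: "norm (average k) \<le> haar (\<lambda>h. \<bar>k h\<bar>)"
proof -
  let ?L = "\<lambda>f x. haar (\<lambda>h. k h * (lip0_apply f (h \<odot> x) - lip0_apply f h))"
  have k0: "0 \<le> haar (\<lambda>h. \<bar>k h\<bar>)" by (intro haar_nonneg continuous_intros k) simp
  have lip: "\<bar>?L f x - ?L f y\<bar> \<le> haar (\<lambda>h. \<bar>k h\<bar>) * norm f * dist x y" for f x y
  proof -
    have "?L f x - ?L f y = haar (\<lambda>h. k h * (lip0_apply f (h \<odot> x) - lip0_apply f (h \<odot> y)))"
      by (subst haar_diff[symmetric]) (auto intro!: continuous_intros k simp: algebra_simps)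
    also have "\<bar>\<dots>\<bar> \<le> haar (\<lambda>h. \<bar>k h\<bar>) * (norm f * dist x y)"
    proof (intro haar_mult_le k continuous_intros)
      show "\<bar>lip0_apply f (h \<odot> x) - lip0_apply f (h \<odot> y)\<bar> \<le> norm f * dist x y" for h
        using lip0_dist_le[of f "h \<odot> x" "h \<odot> y"] by simp
    qed
    finally show ?thesis by (simp add: mult.assoc)
  qed
  have apply_L: "lip0_apply (Lip0 (?L f)) = ?L f" for f
  proof (rule Lip0_inverse, intro CollectI conjI exI)
    show "(haar (\<lambda>h. \<bar>k h\<bar>) * norm f)-lipschitz_on UNIV (?L f)"
      using lip k0 by (intro lipschitz_onI) (auto simp: dist_real_def)
  qed simp
  have bound: "norm (Lip0 (?L f)) \<le> norm f * haar (\<lambda>h. \<bar>k h\<bar>)" for f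
    using lip[of f] k0 by (intro norm_lip0_le) (auto simp: apply_L mult.commute)
  have "bounded_linear (\<lambda>f. Lip0 (?L f))"
  proof (rule bounded_linear_intro[OF _ _ bound]; rule lip0_eqI)
    fix f g :: "'a lip0" and x and r :: real
    show "lip0_apply (Lip0 (?L (f + g))) x = lip0_apply (Lip0 (?L f) + Lip0 (?L g)) x"
      unfolding plus_lip0.rep_eq[of "Lip0 _"] apply_L
      by (subst haar_add[symmetric]) (auto intro!: continuous_intros k simp: plus_lip0.rep_eq algebra_simps)
    show "lip0_apply (Lip0 (?L (r *\<^sub>R f))) x = lip0_apply (r *\<^sub>R Lip0 (?L f)) x"
      unfolding scaleR_lip0.rep_eq[of _ "Lip0 _"] apply_L
      by (subst haar_cmult[symmetric]) (auto intro!: continuous_intros k simp: scaleR_lip0.rep_eq algebra_simps)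
  qed
  then have T: "blinfun_apply (average k) f = Lip0 (?L f)" for f
    unfolding average_def by (simp add: bounded_linear_Blinfun_apply)
  show "lip0_apply (blinfun_apply (average k) f) x = ?L f x" by (simp add: T apply_L)
  show "norm (average k) \<le> haar (\<lambda>h. \<bar>k h\<bar>)"
    using bound k0 by (intro norm_blinfun_bound) (auto simp: T mult.commute)
qed

lemma lip_delta_average_in_span:
  fixes B :: "('a \<Rightarrow>\<^sub>C real) set"
  assumes k: "continuous_on UNIV k" and B: "finite B"
    and c: "\<And>h x. k (h \<odot> ginv x) = (\<Sum>b\<in>B. c x b * apply_bcontfun b h)"
  shows "lip_delta x o\<^sub>L average k \<in> span ((\<lambda>b. density_functional (apply_bcontfun b)) ` B)"
proof -
  have shift: "haar (\<lambda>h. k h * lip0_apply f (h \<odot> x)) =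
      (\<Sum>b\<in>B. c x b * blinfun_apply (density_functional (apply_bcontfun b)) f)" for f x
  proof -
    have "haar (\<lambda>h. k h * lip0_apply f (h \<odot> x)) = haar (\<lambda>h. k (h \<odot> ginv x) * lip0_apply f h)"
      by (subst haar_right[symmetric, of _ "ginv x"]) (intro continuous_intros k, simp)
    also have "\<dots> = haar (\<lambda>h. \<Sum>b\<in>B. c x b * (apply_bcontfun b h * lip0_apply f h))"
      by (simp add: c sum_distrib_right mult.assoc)
    also have "\<dots> = (\<Sum>b\<in>B. c x b * haar (\<lambda>h. apply_bcontfun b h * lip0_apply f h))"
      by (subst haar_sum) (auto intro!: continuous_intros sum.cong haar_cmult)
    finally show ?thesis by (simp add: apply_density_functional)
  qed
  \<comment> \<open>The subtracted constant is the same integral at x = 0, hence the difference of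
    coefficients.\<close>
  have "lip_delta x o\<^sub>L average k = (\<Sum>b\<in>B. (c x b - c 0 b) *\<^sub>R density_functional (apply_bcontfun b))"
  proof (rule blinfun_eqI)
    fix f
    have "blinfun_apply (lip_delta x o\<^sub>L average k) f =
        haar (\<lambda>h. k h * lip0_apply f (h \<odot> x)) - haar (\<lambda>h. k h * lip0_apply f (h \<odot> 0))"
      by (subst haar_diff[symmetric])
        (auto intro!: continuous_intros k simp: lip_delta.rep_eq lip0_apply_average[OF k] right_diff_distrib)
    also have "\<dots> = (\<Sum>b\<in>B. (c x b - c 0 b) * blinfun_apply (density_functional (apply_bcontfun b)) f)"
      unfolding shift by (simp add: sum_subtractf left_diff_distrib)
    finally show "blinfun_apply (lip_delta x o\<^sub>L average k) f =
        blinfun_apply (\<Sum>b\<in>B. (c x b - c 0 b) *\<^sub>R density_functional (apply_bcontfun b)) f"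
      by (simp add: blinfun.sum_left blinfun.scaleR_left)
  qed
  also have "\<dots> \<in> span ((\<lambda>b. density_functional (apply_bcontfun b)) ` B)"
    by (intro span_sum span_scale span_base imageI)
  finally show ?thesis .
qed

lemma ex_almost_identity_average:
  assumes r: "0 < r" and D: "0 \<le> D" "\<And>x :: 'a. dist x 0 \<le> D"
  shows "\<exists>k (B :: ('a \<Rightarrow>\<^sub>C real) set) c. continuous_on UNIV k \<and> finite B \<and>
    (\<forall>h x. k (h \<odot> ginv x) = (\<Sum>b\<in>B. c x b * apply_bcontfun b h)) \<and>
    haar (\<lambda>h. \<bar>k h\<bar>) \<le> 1 + r \<and> (\<forall>x. norm ((lip_delta x o\<^sub>L average k) - lip_delta x) \<le> r * (D + 2))"
proof -
  \<comment> \<open>Without right invariance, dist (h \<odot> x) x may differ from dist h 0. Uniform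
    continuity on the compact product makes it small for all \<open>x\<close> at once when
    \<open>h\<close> is near \<open>0\<close>.\<close>
  have "continuous_on UNIV (\<lambda>(h, x). dist (h \<odot> x) x)"
    unfolding case_prod_beta by (intro continuous_intros)
  from uniformly_continuous_left[OF this r] obtain d where d: "0 < d"
    "\<And>h h' x. dist h h' < d \<Longrightarrow> \<bar>dist (h \<odot> x) x - dist (h' \<odot> x) x\<bar> < r" by blast
  have "0 < min d r" using d r by simp
  from ex_bump[OF this] obtain w where w: "continuous_on UNIV w" "\<And>h. 0 \<le> w h"
    "haar w = 1" "\<And>h. w h \<noteq> 0 \<Longrightarrow> dist h 0 < min d r" by blast
  from translation_finite_approximation[OF w(1) r] obtain k and B :: "('a \<Rightarrow>\<^sub>C real) set" and c where
    k: "continuous_on UNIV k" "finite B" "haar (\<lambda>h. \<bar>k h - w h\<bar>) \<le> r"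
    "\<And>h x. k (h \<odot> ginv x) = (\<Sum>b\<in>B. c x b * apply_bcontfun b h)" by blast
  have "haar (\<lambda>h. \<bar>k h\<bar>) \<le> haar (\<lambda>h. w h + \<bar>k h - w h\<bar>)"
  proof (rule haar_mono)
    show "\<bar>k h\<bar> \<le> w h + \<bar>k h - w h\<bar>" for h using w(2)[of h] by linarith
  qed (intro continuous_intros k w)+
  also have "\<dots> = 1 + haar (\<lambda>h. \<bar>k h - w h\<bar>)"
    by (subst haar_add) (auto intro!: continuous_intros k w simp: w(3))
  finally have k1: "haar (\<lambda>h. \<bar>k h\<bar>) \<le> 1 + r" using k(3) by linarith
  have "norm ((lip_delta x o\<^sub>L average k) - lip_delta x) \<le> r * (D + 2)" for x
  proof (rule norm_blinfun_bound)
    show "0 \<le> r * (D + 2)" using r D by simp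
    fix f :: "'a lip0"
    define g where "g h = lip0_apply f (h \<odot> x) - lip0_apply f h" for h
    have g: "continuous_on UNIV g" unfolding g_def[abs_def] by (intro continuous_intros)
    have "\<bar>g h\<bar> \<le> norm f * D" for h
    proof -
      have "\<bar>g h\<bar> \<le> norm f * dist (h \<odot> x) (h \<odot> 0)"
        using lip0_dist_le[of f "h \<odot> x" "h \<odot> 0"] by (simp add: g_def)
      also have "\<dots> \<le> norm f * D" unfolding dist_mul_left by (intro mult_left_mono D) simp
      finally show ?thesis .
    qed
    then have "\<bar>haar (\<lambda>h. (k h - w h) * g h)\<bar> \<le> haar (\<lambda>h. \<bar>k h - w h\<bar>) * (norm f * D)"
      by (intro haar_mult_le continuous_intros k w g)
    also have "\<dots> \<le> r * (norm f * D)" using k(3) D by (intro mult_right_mono) auto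
    finally have 1: "\<bar>haar (\<lambda>h. (k h - w h) * g h)\<bar> \<le> r * (norm f * D)" .
    \<comment> \<open>On the support of the bump, f (h \<odot> x) is near f x and f h is near f 0 =
      0, each up to norm f * r. The term in D comes from replacing \<open>w\<close> by
      \<open>k\<close>, as left invariance bounds g by norm f * D.\<close>
    have 2: "\<bar>haar (\<lambda>h. w h * g h) - lip0_apply f x\<bar> \<le> norm f * (2 * r)"
    proof (rule haar_weighted_close[OF w(1-3) g])
      fix h assume "w h \<noteq> 0"
      then have h: "dist h 0 < d" "dist h 0 < r" using w(4) by auto
      have "dist (h \<odot> x) x < r" using d(2)[OF h(1), of x] by (simp add: group_left_neutral)
      then have "norm f * dist (h \<odot> x) x \<le> norm f * r" by (intro mult_left_mono) auto
      moreover have "norm f * dist h 0 \<le> norm f * r" using h(2) by (intro mult_left_mono) auto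
      moreover have "\<bar>lip0_apply f h\<bar> \<le> norm f * dist h 0" using lip0_dist_le[of f h 0] by simp
      ultimately show "\<bar>g h - lip0_apply f x\<bar> \<le> norm f * (2 * r)"
        using lip0_dist_le[of f "h \<odot> x" x] unfolding g_def by linarith
    qed
    have "blinfun_apply ((lip_delta x o\<^sub>L average k) - lip_delta x) f = haar (\<lambda>h. k h * g h) - lip0_apply f x"
      by (simp add: blinfun.diff_left lip_delta.rep_eq lip0_apply_average[OF k(1)] g_def)
    also have "haar (\<lambda>h. k h * g h) = haar (\<lambda>h. (k h - w h) * g h) + haar (\<lambda>h. w h * g h)"
      by (subst haar_add[symmetric]) (auto intro!: continuous_intros k w g simp: algebra_simps)
    finally have "\<bar>blinfun_apply ((lip_delta x o\<^sub>L average k) - lip_delta x) f\<bar> \<le> r * (norm f * D) + norm f * (2 * r)"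
      using 1 2 by linarith
    then show "norm (blinfun_apply ((lip_delta x o\<^sub>L average k) - lip_delta x) f) \<le> r * (D + 2) * norm f"
      by (simp add: algebra_simps)
  qed
  with k k1 show ?thesis by blast
qed

lemma metric_approximation_property_lipschitz_free:
  "metric_approximation_property TYPE('a lipschitz_free)"
proof (rule metric_approximation_propertyI)
  fix e :: real assume e: "0 < e"
  obtain D where D: "0 \<le> D" "\<And>x :: 'a. dist x 0 \<le> D" using ex_diameter_bound by blast
  \<comment> \<open>The sum of D + 2, the error of \<open>average k\<close> on point masses, and D,
    the cost of rescaling by 1/(1 + r).\<close>
  define E where "E = 2 * D + 2"
  define r where "r = e / E"
  have E: "0 < E" using D(1) by (simp add: E_def)
  have r: "0 < r" using e E by (simp add: r_def)
  from ex_almost_identity_average[OF r D] obtain k and B :: "('a \<Rightarrow>\<^sub>C real) set" and c where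
    k: "continuous_on UNIV k" and B: "finite B"
    and c: "\<And>h x. k (h \<odot> ginv x) = (\<Sum>b\<in>B. c x b * apply_bcontfun b h)"
    and k1: "haar (\<lambda>h. \<bar>k h\<bar>) \<le> 1 + r"
    and close: "\<And>x. norm ((lip_delta x o\<^sub>L average k) - lip_delta x) \<le> r * (D + 2)" by blast
  define P where "P = (1 / (1 + r)) *\<^sub>R average k"
  have compose: "m o\<^sub>L P = (1 / (1 + r)) *\<^sub>R (m o\<^sub>L average k)" for m :: "'a lip0 \<Rightarrow>\<^sub>L real"
    by (rule blinfun_eqI) (simp add: P_def blinfun.bilinear_simps)
  let ?J = "(\<lambda>b. density_functional (apply_bcontfun b)) ` B"
  have "norm P \<le> 1"
    using norm_average_le[OF k] k1 r by (simp add: P_def)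
  moreover have "lip_delta x o\<^sub>L P \<in> span ?J" for x
    unfolding compose by (intro span_scale lip_delta_average_in_span[OF k B c])
  moreover have "norm ((lip_delta x o\<^sub>L P) - lip_delta x) \<le> e" for x
  proof -
    have "(lip_delta x o\<^sub>L P) - lip_delta x =
        (1 / (1 + r)) *\<^sub>R (((lip_delta x o\<^sub>L average k) - lip_delta x) - r *\<^sub>R lip_delta x)"
    proof -
      have "((lip_delta x o\<^sub>L average k) - lip_delta x) - r *\<^sub>R lip_delta x =
          (lip_delta x o\<^sub>L average k) - (1 + r) *\<^sub>R lip_delta x"
        by (simp add: scaleR_left_distrib)
      moreover have "(1 / (1 + r)) *\<^sub>R (1 + r) *\<^sub>R lip_delta x = lip_delta x" using r by simp
      ultimately show ?thesis by (simp only: compose scaleR_right_diff_distrib)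
    qed
    also have "norm \<dots> \<le> 1 * norm (((lip_delta x o\<^sub>L average k) - lip_delta x) - r *\<^sub>R lip_delta x)"
      unfolding norm_scaleR using r by (intro mult_right_mono) auto
    also have "\<dots> \<le> norm ((lip_delta x o\<^sub>L average k) - lip_delta x) + r * norm (lip_delta x)"
      using norm_triangle_ineq4[of "(lip_delta x o\<^sub>L average k) - lip_delta x" "r *\<^sub>R lip_delta x"] r by simp
    also have "\<dots> \<le> r * (D + 2) + r * D"
      using norm_lip_delta_le[of x] D(2)[of x] r by (intro add_mono close mult_left_mono) auto
    also have "\<dots> = r * E" by (simp add: E_def algebra_simps)
    also have "\<dots> = e" using E by (simp add: r_def)
    finally show ?thesis .
  qed
  moreover have "?J \<subseteq> closure (span (range lip_delta))"
    by (auto intro: density_functional_in_closure)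
  ultimately show "\<exists>(P :: 'a lip0 \<Rightarrow>\<^sub>L 'a lip0) J. finite J \<and> J \<subseteq> closure (span (range lip_delta)) \<and> norm P \<le> 1 \<and>
      (\<forall>x. lip_delta x o\<^sub>L P \<in> span J) \<and> (\<forall>x. norm ((lip_delta x o\<^sub>L P) - lip_delta x) \<le> e)"
    using B by (intro exI[of _ P] exI[of _ ?J]) simp
qed

end

theorem theorem1:
  assumes "compact (UNIV :: 'g::{metric_space, topological_group_add} set)"
    and "left_invariant_dist TYPE('g) \<or> right_invariant_dist TYPE('g)"
  shows "metric_approximation_property TYPE('g lipschitz_free)"
  using assms(2)
proof
  assume left: "left_invariant_dist TYPE('g)"
  interpret compact_metric_group "(+) :: 'g \<Rightarrow> 'g \<Rightarrow> 'g" uminus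
    using assms(1) left unfolding left_invariant_dist_def
    by unfold_locales (auto simp: add.assoc case_prod_beta intro!: continuous_intros)
  show ?thesis by (rule metric_approximation_property_lipschitz_free)
next
  assume right: "right_invariant_dist TYPE('g)"
  interpret compact_metric_group "\<lambda>x y :: 'g. y + x" uminus
    using assms(1) right unfolding right_invariant_dist_def
    by unfold_locales (auto simp: add.assoc case_prod_beta intro!: continuous_intros)
  show ?thesis by (rule metric_approximation_property_lipschitz_free)
qed

end
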